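(* Let $G=(V,E)$ be a tree with $1<|V|<\infty$ and edge weights $q=(q_e)_{e\in E}$, and let $d_v=|\{u\in V:\{u,v\}\in E\}|$ be the degree of $v\in V$. (i) Assume that $q\in(-\infty,1)^E$, $\beta>0$ and $a\in(0,\infty)^V$. Then $\mathrm{TB}^G_{\mathrm I}(a,\beta,q)$, with density $$c_{\mathrm I}\,\Delta_G(k)^{\beta-1}\prod_{v\in V}k_v^{a_v-1}\,\mathbf 1_{\mathcal D}(k),$$ is a probability measure, and the normalizing constant $c_{\mathrm I}$ takes the form $$c_{\mathrm I}=\frac{1}{\Gamma(\beta)\prod_{v\in V}\bigl[\Gamma(a_v)\Gamma(a_v+\beta)^{d_v-1}\bigr]}\prod_{\{u,w\}\in E}\frac{\Gamma(a_u+a_w+\beta)}{{}_2F_1(a_u,a_w;a_u+a_w+\beta;q_{u,w})}.$$ (ii) Assume that $q\in[0,\infty)^E$, $\beta>0$, $a\in(0,\beta)^V$, and that $\beta>a_u+a_v$ whenever $\{u,v\}\in E$ and $q_{u,v}=0$. Then $\mathrm{TB}^G_{\mathrm{II}}(a,\beta,q)$, with density $$c_{\mathrm{II}}\,\delta_G(k)^{-\beta}\prod_{v\in V}k_v^{a_v-1}\,\mathbf 1_{(0,\infty)^V}(k),$$ is a probability measure, and the normalizing constant $c_{\mathrm{II}}$ takes the form $$c_{\mathrm{II}}=\frac{\Gamma(\beta)^{|V|}}{\prod_{v\in V}\bigl[\Gamma(a_v)\Gamma(\beta-a_v)\bigr]}\;\frac{1}{\prod_{\{u,w\}\in E}{}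_2F_1(a_u,a_w;\beta;1-q_{u,w})}.$$
   Context: For $e=\{v,w\}\in E$ write $q_{v,w}=q_{w,v}=q_e$. For $U\subseteq V$ let $E_U$ be the set of edges of $G$ with both ends in $U$, $k^U=\prod_{v\in U}k_v$, $q^{E_U}=\prod_{e\in E_U}q_e$ (empty products equal $1$). For $U\subseteq V$ and $k\in\mathbb R^V$, $$\Delta_U(k)=\sum_{W\subseteq U}(-1)^{|W|}q^{E_W}k^W,\qquad \delta_U(k)=\sum_{W\subseteq U}q^{E_W}k^W,$$ and $\Delta_G=\Delta_V$, $\delta_G=\delta_V$. Put $\mathcal D=\{k\in(0,1)^V:\ \Delta_U(k)>0\ \ \forall\, U\subseteq V\}$. Densities are with respect to Lebesgue measure on $\mathbb R^V$. $\Gamma$ is the Euler gamma function and ${}_2F_1$ is the Gauss hypergeometric function (for real argument $<1$ defined by the principal branch of its analytic continuation, e.g. through the Euler integral representation; at argument $1$ it is the value of the convergent series). *)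

theory Defs
  imports "HOL-Probability.Probability" "HOL-Complex_Analysis.Complex_Analysis"
begin

section \<open>Finite trees\<close>

text \<open>An undirected edge is a two-element set of vertices; edge weights are functions
  \<open>q :: 'v set \<Rightarrow> real\<close>, of which only the values on \<open>E\<close> matter.\<close>

definition simple_graph :: "'v set \<Rightarrow> 'v set set \<Rightarrow> bool" where
  "simple_graph V E \<longleftrightarrow> E \<subseteq> {{u, w} | u w. u \<in> V \<and> w \<in> V \<and> u \<noteq> w}"

definition graph_connected :: "'v set \<Rightarrow> 'v set set \<Rightarrow> bool" where
  "graph_connected V E \<longleftrightarrow>
     V \<noteq> {} \<and> (\<forall>u\<in>V. \<forall>w\<in>V. (u, w) \<in> {(x, y). {x, y} \<in> E}\<^sup>*)"

definition graph_cycle :: "'v set set \<Rightarrow> 'v list \<Rightarrow> bool" where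
  "graph_cycle E xs \<longleftrightarrow> 3 \<le> length xs \<and> distinct xs \<and>
     (\<forall>i<length xs. {xs ! i, xs ! (Suc i mod length xs)} \<in> E)"

definition tree_graph :: "'v set \<Rightarrow> 'v set set \<Rightarrow> bool" where
  "tree_graph V E \<longleftrightarrow>
     simple_graph V E \<and> graph_connected V E \<and> \<not> (\<exists>xs. graph_cycle E xs)"

definition degree_in :: "'v set \<Rightarrow> 'v set set \<Rightarrow> 'v \<Rightarrow> nat" where
  "degree_in V E v = card {u \<in> V. {u, v} \<in> E}"

text \<open>The common value of \<open>f u w\<close> over the two ways of writing \<open>e = {u, w}\<close>; it is only used
  for symmetric \<open>f\<close>, for which it is well defined.\<close>

definition on_ends :: "('v \<Rightarrow> 'v \<Rightarrow> 'b) \<Rightarrow> 'v set \<Rightarrow> 'b" where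
  "on_ends f e = (THE y. \<forall>u w. e = {u, w} \<longrightarrow> y = f u w)"

lemma on_ends_eq:
  assumes "f u w = f w u"
  shows "on_ends f {u, w} = f u w"
  unfolding on_ends_def
  using assms by (intro the_equality) (auto simp: doubleton_eq_iff)


section \<open>The Gauss hypergeometric function\<close>

text \<open>Real parameters and a real argument \<open>x \<le> 1\<close>. For \<open>x < 1\<close> this is the value at \<open>x\<close> of
  the analytic continuation of the Gauss series from the unit disc to the plane cut along
  \<open>[1, \<infinity>)\<close>, i.e. of the principal branch; at \<open>x = 1\<close> it is the sum of the series itself.\<close>

definition hyp2F1 :: "real \<Rightarrow> real \<Rightarrow> real \<Rightarrow> real \<Rightarrow> real" where
  "hyp2F1 a b c x =
     (if x = 1 then eval_fps (fps_hypergeo [a, b] [c] 1) 1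
      else Re (THE y. \<exists>F. F holomorphic_on - (complex_of_real ` {1..}) \<and>
             (\<forall>z\<in>ball 0 1.
                F z = eval_fps (fps_hypergeo [of_real a, of_real b] [of_real c] 1) z) \<and>
             y = F (complex_of_real x)))"

lemma hyp2F1_commute: "hyp2F1 a b c x = hyp2F1 b a c x"
  by (simp add: hyp2F1_def fps_hypergeo_def mult.commute)

lemma hyp2F1_eqI:
  assumes F: "F holomorphic_on - (complex_of_real ` {1..})"
    and F_ball: "\<And>z. z \<in> ball 0 1 \<Longrightarrow>
      F z = eval_fps (fps_hypergeo [of_real a, of_real b] [of_real c] 1) z"
    and x: "x < 1"
  shows "hyp2F1 a b c x = Re (F (complex_of_real x))"
proof -
  let ?S = "- (complex_of_real ` {1..})"
  have cut: "complex_of_real ` {1..} = {z. Im z = 0 \<and> 1 \<le> Re z}"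
    by (auto simp: complex_eq_iff intro!: image_eqI[where x = "Re z" for z])
  have "closed {z. Im z = 0 \<and> 1 \<le> Re z}"
    by (intro closed_Collect_conj closed_Collect_eq closed_Collect_le continuous_intros)
  hence op: "open ?S" unfolding cut by (rule open_Compl)
  have "starlike ?S"
    unfolding starlike_def
  proof (intro bexI ballI subsetI)
    fix z y assume z: "z \<in> ?S" and "y \<in> closed_segment 0 z"
    then obtain t where t: "0 \<le> t" "t \<le> 1" "y = t *\<^sub>R z"
      by (auto simp: closed_segment_def)
    have "False" if "Im y = 0" "1 \<le> Re y"
    proof -
      have "t \<noteq> 0" using that t by auto
      hence "Im z = 0" using that t by simp
      moreover have "Re z > 0" using that t mult_nonneg_nonpos[of t "Re z"] by (cases "Re z > 0") auto
      then have "t * Re z \<le> 1 * Re z" using t by (intro mult_right_mono) auto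
      then have "1 \<le> Re z" using that t by simp
      ultimately show False using z unfolding cut by auto
    qed
    then show "y \<in> ?S" unfolding cut by auto
  qed (auto simp: cut)
  hence conn: "connected ?S" by (rule starlike_imp_connected)
  have ball: "ball 0 1 \<subseteq> ?S"
    by (auto simp: norm_of_real)
  have xS: "complex_of_real x \<in> ?S" using x by auto
  have "G (of_real x) = F (of_real x)"
    if "G holomorphic_on ?S"
      "\<forall>z\<in>ball 0 1. G z = eval_fps (fps_hypergeo [of_real a, of_real b] [of_real c] 1) z" for G
    by (rule analytic_continuation_open[OF _ op _ conn ball that(1) F _ xS])
       (use that(2) F_ball in auto)
  with F F_ball have "(THE y. \<exists>G. G holomorphic_on ?S \<and>
      (\<forall>z\<in>ball 0 1. G z = eval_fps (fps_hypergeo [of_real a, of_real b] [of_real c] 1) z) \<and>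
      y = G (complex_of_real x)) = F (complex_of_real x)"
    by (intro the_equality) blast+
  with x show ?thesis by (simp add: hyp2F1_def)
qed


section \<open>The tree beta measures\<close>

definition edge_weight_prod :: "'v set set \<Rightarrow> ('v set \<Rightarrow> real) \<Rightarrow> 'v set \<Rightarrow> real" where
  "edge_weight_prod E q W = (\<Prod>e\<in>{e \<in> E. e \<subseteq> W}. q e)"

definition Delta :: "'v set set \<Rightarrow> ('v set \<Rightarrow> real) \<Rightarrow> 'v set \<Rightarrow> ('v \<Rightarrow> real) \<Rightarrow> real" where
  "Delta E q U k = (\<Sum>W\<in>Pow U. (-1) ^ card W * edge_weight_prod E q W * (\<Prod>v\<in>W. k v))"

definition delta :: "'v set set \<Rightarrow> ('v set \<Rightarrow> real) \<Rightarrow> 'v set \<Rightarrow> ('v \<Rightarrow> real) \<Rightarrow> real" where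
  "delta E q U k = (\<Sum>W\<in>Pow U. edge_weight_prod E q W * (\<Prod>v\<in>W. k v))"

text \<open>Points of \<open>\<real>\<^sup>V\<close> are the functions in \<^term>\<open>PiE V (\<lambda>_. UNIV)\<close>, the space of the
  product measure below.\<close>

definition lebesgue_on_vertices :: "'v set \<Rightarrow> ('v \<Rightarrow> real) measure" where
  "lebesgue_on_vertices V = Pi\<^sub>M V (\<lambda>_. lborel)"

definition TB_domain :: "'v set \<Rightarrow> 'v set set \<Rightarrow> ('v set \<Rightarrow> real) \<Rightarrow> ('v \<Rightarrow> real) set" where
  "TB_domain V E q = {k \<in> PiE V (\<lambda>_. {0<..<1}). \<forall>U\<subseteq>V. Delta E q U k > 0}"

definition TB_I_kernel ::
  "'v set \<Rightarrow> 'v set set \<Rightarrow> ('v \<Rightarrow> real) \<Rightarrow> real \<Rightarrow> ('v set \<Rightarrow> real) \<Rightarrow> ('v \<Rightarrow> real) \<Rightarrow> real" where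
  "TB_I_kernel V E a \<beta> q k =
     Delta E q V k powr (\<beta> - 1) * (\<Prod>v\<in>V. k v powr (a v - 1)) * indicator (TB_domain V E q) k"

definition TB_II_kernel ::
  "'v set \<Rightarrow> 'v set set \<Rightarrow> ('v \<Rightarrow> real) \<Rightarrow> real \<Rightarrow> ('v set \<Rightarrow> real) \<Rightarrow> ('v \<Rightarrow> real) \<Rightarrow> real" where
  "TB_II_kernel V E a \<beta> q k =
     delta E q V k powr (- \<beta>) * (\<Prod>v\<in>V. k v powr (a v - 1)) *
     indicator (PiE V (\<lambda>_. {0<..})) k"

text \<open>If the kernel is not integrable then the Bochner integral, hence also the constant and
  the density, is zero, and the resulting measure is not a probability measure.\<close>

definition normalizing_const :: "'v set \<Rightarrow> (('v \<Rightarrow> real) \<Rightarrow> real) \<Rightarrow> real" where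
  "normalizing_const V f = 1 / (\<integral>k. f k \<partial>lebesgue_on_vertices V)"

definition c_I ::
  "'v set \<Rightarrow> 'v set set \<Rightarrow> ('v \<Rightarrow> real) \<Rightarrow> real \<Rightarrow> ('v set \<Rightarrow> real) \<Rightarrow> real" where
  "c_I V E a \<beta> q = normalizing_const V (TB_I_kernel V E a \<beta> q)"

definition c_II ::
  "'v set \<Rightarrow> 'v set set \<Rightarrow> ('v \<Rightarrow> real) \<Rightarrow> real \<Rightarrow> ('v set \<Rightarrow> real) \<Rightarrow> real" where
  "c_II V E a \<beta> q = normalizing_const V (TB_II_kernel V E a \<beta> q)"

definition TB_I ::
  "'v set \<Rightarrow> 'v set set \<Rightarrow> ('v \<Rightarrow> real) \<Rightarrow> real \<Rightarrow> ('v set \<Rightarrow> real) \<Rightarrow> ('v \<Rightarrow> real) measure" where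
  "TB_I V E a \<beta> q =
     density (lebesgue_on_vertices V) (\<lambda>k. ennreal (c_I V E a \<beta> q * TB_I_kernel V E a \<beta> q k))"

definition TB_II ::
  "'v set \<Rightarrow> 'v set set \<Rightarrow> ('v \<Rightarrow> real) \<Rightarrow> real \<Rightarrow> ('v set \<Rightarrow> real) \<Rightarrow> ('v \<Rightarrow> real) measure" where
  "TB_II V E a \<beta> q =
     density (lebesgue_on_vertices V) (\<lambda>k. ennreal (c_II V E a \<beta> q * TB_II_kernel V E a \<beta> q k))"

end

theory Submission
  imports Defs
begin

text \<open>
  Let \<open>l\<close> be a leaf attached to \<open>p\<close>, let \<open>q\<close> be the weight of the edge between them, and put
  \<open>s = (1 - q k\<^sub>l) / (1 - k\<^sub>l)\<close>. Then \<open>\<Delta>(k) = (1 - k\<^sub>l) \<Delta>'(k')\<close>, where \<open>\<Delta>'\<close> belongs to the tree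
  without \<open>l\<close> and \<open>k'\<close> arises from \<open>k\<close> by multiplying \<open>k\<^sub>p\<close> by \<open>s\<close>; the domain splits accordingly.
  For fixed \<open>k\<^sub>l\<close> the substitution \<open>k \<mapsto> k'\<close> only scales one coordinate, so integrating the kernel
  over it leaves the kernel integral of the smaller tree times an Euler integral in \<open>k\<^sub>l\<close>, which
  contributes one hypergeometric factor per edge. The second family is the same computation with
  signs changed, after the substitution \<open>k\<^sub>l = t / (1 - t)\<close>.
\<close>

section \<open>Trees grown leaf by leaf\<close>

text \<open>The scaling produces the Jacobian 1/s and, from the coordinate of \<open>p\<close>, the
  power s^(1 - a_p). Together they give s^(-a_p), hence the exponent -a_p in Euler's integral and,
  in the first family, the factor Beta(a_l, a_p + \<beta>) per edge. So Gamma(a_p + \<beta>) appears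
  once for each leaf attached at \<open>p\<close>; the root starts with exponent -1 and a new leaf
  with exponent 0, which makes the final exponent the degree minus 1. In the second family the
  factor is Beta(a_l, \<beta> - a_l), which involves the leaf alone, so no degrees occur. Two
  obstacles shape the proof. \<open>hyp2F1\<close> is an analytic continuation, so the Euler
  integral must be shown holomorphic on the cut plane and equal to the Gauss series on the disc;
  argument 1, reached in the second family at weight 0, is treated separately by summing a
  nonnegative series. And trees are given as connected graphs without cycles, while the induction
  needs an order in which leaves are attached. Integrals are computed in \<open>ennreal\<close>, so
  convergence comes with the value.\<close>

inductive grown_tree :: "'v set \<Rightarrow> 'v set set \<Rightarrow> bool" where
  singleton: "grown_tree {r} {}"
| leaf: "grown_tree U F \<Longrightarrow> p \<in> U \<Longrightarrow> l \<notin> U \<Longrightarrow> grown_tree (insert l U) (insert {l, p} F)"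

lemma grown_treeD:
  assumes "grown_tree U F"
  shows "finite U" "U \<noteq> {}" "finite F" "\<And>e. e \<in> F \<Longrightarrow> e \<subseteq> U" "{} \<notin> F" "\<And>u. {u} \<notin> F"
  using assms by (induction) auto

text \<open>Supplies the simple path between two neighbours of an outside vertex; closing it through
  that vertex yields the cycle that acyclicity forbids.\<close>

lemma grown_tree_path:
  assumes "grown_tree U F" "u \<in> U" "w \<in> U"
  shows "\<exists>xs. xs \<noteq> [] \<and> hd xs = u \<and> last xs = w \<and> distinct xs \<and> set xs \<subseteq> U \<and>
           successively (\<lambda>x y. {x, y} \<in> F) xs"
  using assms
proof (induction arbitrary: u w)
  case (singleton r)
  then show ?case by (intro exI[of _ "[r]"]) auto
next
  case (leaf U F p l)
  have mono: "successively (\<lambda>x y. {x, y} \<in> insert {l, p} F) xs"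
    if "successively (\<lambda>x y. {x, y} \<in> F) xs" for xs
    using that by (rule successively_mono) auto
  have from_leaf: "\<exists>xs. xs \<noteq> [] \<and> hd xs = l \<and> last xs = w \<and> distinct xs \<and> set xs \<subseteq> insert l U \<and>
           successively (\<lambda>x y. {x, y} \<in> insert {l, p} F) xs" if w: "w \<in> insert l U" for w
  proof (cases "w = l")
    case True
    then show ?thesis by (intro exI[of _ "[l]"]) auto
  next
    case False
    then obtain xs where xs: "xs \<noteq> []" "hd xs = p" "last xs = w" "distinct xs" "set xs \<subseteq> U"
        "successively (\<lambda>x y. {x, y} \<in> F) xs"
      using leaf.IH[of p w] leaf.hyps w by blast
    then show ?thesis using leaf.hyps mono[of xs]
      by (intro exI[of _ "l # xs"]) (auto simp: successively_Cons)
  qed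
  show ?case
  proof (cases "u = l")
    case True
    then show ?thesis using from_leaf leaf.prems by blast
  next
    case u: False
    show ?thesis
    proof (cases "w = l")
      case True
      obtain xs where xs: "xs \<noteq> []" "hd xs = l" "last xs = u" "distinct xs" "set xs \<subseteq> insert l U"
        "successively (\<lambda>x y. {x, y} \<in> insert {l, p} F) xs"
        using from_leaf leaf.prems by blast
      have "successively (\<lambda>x y. {x, y} \<in> insert {l, p} F) (rev xs)"
        using xs(6) by (simp add: successively_rev insert_commute)
      then show ?thesis using xs True
        by (intro exI[of _ "rev xs"]) (auto simp: hd_rev last_rev)
    next
      case False
      then obtain xs where "xs \<noteq> []" "hd xs = u" "last xs = w" "distinct xs" "set xs \<subseteq> U"
        "successively (\<lambda>x y. {x, y} \<in> F) xs"
        using leaf.IH[of u w] leaf.prems u by blast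
      then show ?thesis using mono[of xs] by blast
    qed
  qed
qed

lemma rtrancl_leaves_set:
  assumes "(u, w) \<in> r\<^sup>*" "u \<in> U" "w \<notin> U"
  shows "\<exists>x y. x \<in> U \<and> y \<notin> U \<and> (x, y) \<in> r"
  using assms by (induction) auto

lemma graph_cycle_Cons:
  assumes "successively (\<lambda>x y. {x, y} \<in> E) xs" "distinct xs" "l \<notin> set xs" "2 \<le> length xs"
    and "{l, hd xs} \<in> E" "{last xs, l} \<in> E"
  shows "graph_cycle E (l # xs)"
  unfolding graph_cycle_def
proof (intro conjI allI impI)
  fix i assume i: "i < length (l # xs)"
  have ne: "xs \<noteq> []" using assms by auto
  show "{(l # xs) ! i, (l # xs) ! (Suc i mod length (l # xs))} \<in> E"
  \<comment> \<open>\<open>length xs\<close> is the last index of \<open>l # xs\<close>; there the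
    successor wraps around to \<open>l\<close>, and the edge from \<open>last xs\<close> back to
    \<open>l\<close> is used.\<close>
  proof (cases "i = length xs")
    case True
    then show ?thesis using assms ne by (simp add: last_conv_nth nth_Cons')
  next
    case False
    then show ?thesis using assms i ne
      by (cases i) (auto simp: successively_conv_nth hd_conv_nth)
  qed
qed (use assms in auto)

text \<open>Among the vertex sets whose induced subgraph can be grown, take a maximal
  \<open>U\<close>. If \<open>U\<close> were not all of \<open>V\<close>, connectedness would give
  an edge from some \<open>p\<close> in \<open>U\<close> to some \<open>l\<close> outside; without
  cycles \<open>l\<close> has no second neighbour in \<open>U\<close>, so it is a leaf of the
  subgraph induced on \<open>insert l U\<close>, against maximality.\<close>

lemma tree_graph_imp_grown_tree:
  assumes fin: "finite V" and tree: "tree_graph V E"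
  shows "grown_tree V E"
proof -
  have sg: "E \<subseteq> {{u, w} | u w. u \<in> V \<and> w \<in> V \<and> u \<noteq> w}"
    and conn: "V \<noteq> {}" "\<And>u w. u \<in> V \<Longrightarrow> w \<in> V \<Longrightarrow> (u, w) \<in> {(x, y). {x, y} \<in> E}\<^sup>*"
    and acyc: "\<And>xs. \<not> graph_cycle E xs"
    using tree by (auto simp: tree_graph_def simple_graph_def graph_connected_def)
  define \<A> where "\<A> = {U. U \<subseteq> V \<and> grown_tree U {e \<in> E. e \<subseteq> U}}"
  obtain r where r: "r \<in> V" using conn by auto
  have "{e \<in> E. e \<subseteq> {r}} = {}" using sg by auto
  then have "grown_tree {r} {e \<in> E. e \<subseteq> {r}}" using singleton[of r] by (simp only:)
  then have "{r} \<in> \<A>" using r by (simp add: \<A>_def)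
  moreover have "finite \<A>" using fin by (simp add: \<A>_def)
  ultimately obtain U where U: "U \<in> \<A>" and max: "\<And>W. W \<in> \<A> \<Longrightarrow> U \<subseteq> W \<Longrightarrow> U = W"
    using finite_has_maximal[of \<A>] by blast
  have UV: "U \<subseteq> V" and gU: "grown_tree U {e \<in> E. e \<subseteq> U}" using U by (auto simp: \<A>_def)
  have "U = V"
  proof (rule ccontr)
    assume "U \<noteq> V"
    then obtain u w where "u \<in> U" "w \<in> V" "w \<notin> U" using UV grown_treeD(2)[OF gU] by auto
    with conn(2)[of u w] UV obtain p l where pl: "p \<in> U" "l \<notin> U" "{p, l} \<in> E"
      using rtrancl_leaves_set[of u w "{(x, y). {x, y} \<in> E}" U] by auto
    have lV: "l \<in> V" using pl sg by (auto simp: doubleton_eq_iff)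
    have "{e \<in> E. e \<subseteq> insert l U} = insert {l, p} {e \<in> E. e \<subseteq> U}"
    proof (intro equalityI subsetI)
      fix e assume e: "e \<in> {e \<in> E. e \<subseteq> insert l U}"
      show "e \<in> insert {l, p} {e \<in> E. e \<subseteq> U}"
      proof (cases "e \<subseteq> U")
        case False
        obtain x y where "e = {x, y}" "x \<noteq> y" using e sg by auto
        with e False obtain p' where p': "e = {l, p'}" "p' \<in> U" by fastforce
        \<comment> \<open>A path in \<open>U\<close> between two distinct neighbours
          \<open>p\<close> and \<open>p'\<close> of \<open>l\<close> would close up through
          \<open>l\<close>.\<close>
        have "p' = p"
        proof (rule ccontr)
          assume ne: "p' \<noteq> p"
          obtain xs where xs: "xs \<noteq> []" "hd xs = p" "last xs = p'" "distinct xs" "set xs \<subseteq> U"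
            "successively (\<lambda>x y. {x, y} \<in> {e \<in> E. e \<subseteq> U}) xs"
            using grown_tree_path[OF gU pl(1) p'(2)] by blast
          have "successively (\<lambda>x y. {x, y} \<in> E) xs"
            using xs(6) by (rule successively_mono) auto
          \<comment> \<open>\<open>remdups_adj.cases\<close> merely splits lists into empty,
            singleton and longer; a singleton would force \<open>p = p'\<close>.\<close>
          moreover have "2 \<le> length xs"
            using xs(1-3) ne by (cases xs rule: remdups_adj.cases) auto
          ultimately have "graph_cycle E (l # xs)"
            using xs pl p' e by (intro graph_cycle_Cons) (auto simp: insert_commute)
          then show False using acyc by blast
        qed
        then show ?thesis using p' by simp
      qed (use e in auto)
    qed (use pl in \<open>auto simp: insert_commute\<close>)
    then have "insert l U \<in> \<A>"
      using leaf[OF gU pl(1,2)] lV UV by (simp add: \<A>_def)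
    then show False using max[of "insert l U"] pl by blast
  qed
  moreover have "{e \<in> E. e \<subseteq> V} = E" using sg by auto
  ultimately show ?thesis using gU by simp
qed

lemma degree_in_grown_leaf:
  assumes "grown_tree U F" "p \<in> U" "l \<notin> U"
  shows "degree_in (insert l U) (insert {l, p} F) l = 1"
    and "degree_in (insert l U) (insert {l, p} F) p = Suc (degree_in U F p)"
    and "v \<in> U - {p} \<Longrightarrow> degree_in (insert l U) (insert {l, p} F) v = degree_in U F v"
proof -
  note F = grown_treeD[OF assms(1)]
  have l: "l \<notin> e" if "e \<in> F" for e using F(4)[OF that] assms by auto
  have "{u \<in> insert l U. {u, l} \<in> insert {l, p} F} = {p}"
    using assms l by (auto simp: doubleton_eq_iff)
  then show "degree_in (insert l U) (insert {l, p} F) l = 1" by (simp add: degree_in_def)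
  have "{u \<in> insert l U. {u, p} \<in> insert {l, p} F} = insert l {u \<in> U. {u, p} \<in> F}"
    using assms l by (auto simp: doubleton_eq_iff)
  then show "degree_in (insert l U) (insert {l, p} F) p = Suc (degree_in U F p)"
    using assms F(1) by (simp add: degree_in_def)
  assume "v \<in> U - {p}"
  then have "{u \<in> insert l U. {u, v} \<in> insert {l, p} F} = {u \<in> U. {u, v} \<in> F}"
    using assms l by (auto simp: doubleton_eq_iff)
  then show "degree_in (insert l U) (insert {l, p} F) v = degree_in U F v"
    by (simp add: degree_in_def)
qed


section \<open>Splitting off a leaf\<close>

text \<open>Lets the algebra be done once, for the polynomial without signs, and transferred to
  \<open>Delta\<close>.\<close>

lemma Delta_eq_delta: "Delta E q U k = delta E q U (\<lambda>v. - k v)"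
  unfolding Delta_def delta_def by (intro sum.cong refl) (simp add: prod_uminus mult_ac)

lemma delta_cong:
  assumes "\<And>v. v \<in> U \<Longrightarrow> k v = k' v"
  shows "delta E q U k = delta E q U k'"
  unfolding delta_def by (intro sum.cong refl arg_cong2[where f = "(*)"] prod.cong) (use assms in auto)

lemma sum_Pow_insert:
  assumes "finite U" "p \<notin> U"
  shows "(\<Sum>W\<in>Pow (insert p U). f W) = (\<Sum>W\<in>Pow U. f W + f (insert p W))"
proof -
  have inj: "inj_on (insert p) (Pow U)" using assms by (auto simp: inj_on_def)
  have "(\<Sum>W\<in>Pow (insert p U). f W) = (\<Sum>W\<in>Pow U. f W) + (\<Sum>W\<in>insert p ` Pow U. f W)"
    unfolding Pow_insert using assms by (intro sum.union_disjoint) auto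
  then show ?thesis using sum.reindex[OF inj, of f] by (simp add: sum.distrib)
qed

text \<open>\<open>delta\<close> is affine in each single coordinate, and setting coordinate
  \<open>p\<close> to 0 leaves \<open>delta\<close> of \<open>U - {p}\<close>. The identity
  interpolates between the arguments 0 and \<open>x\<close>.\<close>

lemma delta_fun_upd_scale:
  assumes "finite U" "p \<in> U"
  shows "delta E q U (k(p := t * x)) = (1 - t) * delta E q (U - {p}) k + t * delta E q U (k(p := x))"
proof -
  define U' where "U' = U - {p}"
  have U: "U = insert p U'" "finite U'" "p \<notin> U'" using assms by (auto simp: U'_def)
  have "delta E q U (k(p := y)) = delta E q U' k +
      y * (\<Sum>W\<in>Pow U'. edge_weight_prod E q (insert p W) * (\<Prod>v\<in>W. k v))" for y
  proof -
    have upd: "prod (k(p := y)) W = prod k W" "prod (k(p := y)) (insert p W) = y * prod k W" if "W \<in> Pow U'" for W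
    proof -
      have *: "p \<notin> W" "finite W" using that U finite_subset by auto
      then show "prod (k(p := y)) W = prod k W" by (intro prod.cong) auto
      with * show "prod (k(p := y)) (insert p W) = y * prod k W" by simp
    qed
    show ?thesis
      unfolding delta_def U(1) sum_Pow_insert[OF U(2,3)]
      using upd by (simp add: sum.distrib sum_distrib_left mult_ac)
  qed
  then show ?thesis unfolding U'_def by (simp add: algebra_simps)
qed

lemma edge_weight_prod_leaf:
  assumes "grown_tree U F" "p \<in> U" "l \<notin> U" "W \<subseteq> U"
  shows "edge_weight_prod (insert {l, p} F) q W = edge_weight_prod F q W"
    and "edge_weight_prod (insert {l, p} F) q (insert l W) =
           (if p \<in> W then q {l, p} else 1) * edge_weight_prod F q W"
proof -
  note F = grown_treeD[OF assms(1)]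
  have l: "l \<notin> e" if "e \<in> F" for e using F(4)[OF that] assms by auto
  show "edge_weight_prod (insert {l, p} F) q W = edge_weight_prod F q W"
    unfolding edge_weight_prod_def using assms by (intro prod.cong) auto
  have "{e \<in> insert {l, p} F. e \<subseteq> insert l W} =
      (if p \<in> W then insert {l, p} {e \<in> F. e \<subseteq> W} else {e \<in> F. e \<subseteq> W})"
    using assms l by auto
  moreover have "{l, p} \<notin> F" using l by blast
  ultimately show "edge_weight_prod (insert {l, p} F) q (insert l W) =
           (if p \<in> W then q {l, p} else 1) * edge_weight_prod F q W"
    unfolding edge_weight_prod_def using F by auto
qed

text \<open>Pair each \<open>S\<close> avoiding \<open>l\<close> with \<open>insert l S\<close>. The
  new edge lies in \<open>insert l S\<close> exactly when \<open>p\<close> is in \<open>S\<close>,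
  so the pair carries the factor 1 + q k_l if \<open>p\<close> is in \<open>S\<close> and 1 + k_l
  otherwise. After extracting 1 + k_l, what remains is a factor s for precisely those
  \<open>S\<close> that contain \<open>p\<close>, which amounts to multiplying k_p by s.\<close>

lemma delta_leaf:
  assumes "grown_tree U F" "p \<in> U" "l \<notin> U" "W \<subseteq> U"
  shows "delta (insert {l, p} F) q W k = delta F q W k"
    and "1 + k l \<noteq> 0 \<Longrightarrow> delta (insert {l, p} F) q (insert l W) k =
           (1 + k l) * delta F q W (k(p := k p * ((1 + q {l, p} * k l) / (1 + k l))))"
proof -
  note F = grown_treeD[OF assms(1)]
  show "delta (insert {l, p} F) q W k = delta F q W k"
    unfolding delta_def using assms edge_weight_prod_leaf(1)[OF assms(1-3)]
    by (intro sum.cong) auto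
  assume nz: "1 + k l \<noteq> 0"
  define s where "s = (1 + q {l, p} * k l) / (1 + k l)"
  have W: "finite W" "l \<notin> W" using assms F(1) by (auto intro: finite_subset)
  have upd: "prod (k(p := k p * s)) S = (if p \<in> S then s else 1) * prod k S" if "finite S" for S
  proof (cases "p \<in> S")
    case True
    have "prod (k(p := k p * s)) S = (k p * s) * prod (k(p := k p * s)) (S - {p})"
      using prod.remove[OF that True, of "k(p := k p * s)"] by simp
    also have "prod (k(p := k p * s)) (S - {p}) = prod k (S - {p})"
      by (intro prod.cong) auto
    finally show ?thesis using prod.remove[OF that True, of k] True by simp
  qed (auto intro!: prod.cong)
  show "delta (insert {l, p} F) q (insert l W) k =
           (1 + k l) * delta F q W (k(p := k p * ((1 + q {l, p} * k l) / (1 + k l))))"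
    unfolding delta_def sum_Pow_insert[OF W] sum_distrib_left s_def[symmetric]
  proof (intro sum.cong refl)
    fix S assume "S \<in> Pow W"
    then have S: "S \<subseteq> U" "finite S" "l \<notin> S" using assms W finite_subset by auto
    have "(1 + k l) * s = 1 + q {l, p} * k l" using nz by (simp add: s_def)
    then have X: "(1 + k l) * (X * (s * Y)) = (1 + q {l, p} * k l) * (X * Y)" for X Y
      by (metis mult.assoc mult.left_commute)
    show "edge_weight_prod (insert {l, p} F) q S * prod k S +
         edge_weight_prod (insert {l, p} F) q (insert l S) * prod k (insert l S) =
         (1 + k l) * (edge_weight_prod F q S * prod (k(p := k p * s)) S)"
      using upd[OF S(2)] S edge_weight_prod_leaf[OF assms(1-3) S(1), of q]
        X[of "edge_weight_prod F q S" "prod k S"]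
      by (cases "p \<in> S") (simp_all add: ring_distribs mult_ac)
  qed
qed

lemma Delta_leaf:
  assumes "grown_tree U F" "p \<in> U" "l \<notin> U" "W \<subseteq> U"
  shows "Delta (insert {l, p} F) q W k = Delta F q W k"
    and "k l \<noteq> 1 \<Longrightarrow> Delta (insert {l, p} F) q (insert l W) k =
           (1 - k l) * Delta F q W (k(p := k p * ((1 - q {l, p} * k l) / (1 - k l))))"
proof -
  show "Delta (insert {l, p} F) q W k = Delta F q W k"
    using delta_leaf(1)[OF assms] by (simp add: Delta_eq_delta)
  have *: "(\<lambda>v. - k v)(p := - k p * s) = (\<lambda>v. - (k(p := k p * s)) v)" for s by auto
  show "k l \<noteq> 1 \<Longrightarrow> Delta (insert {l, p} F) q (insert l W) k =
           (1 - k l) * Delta F q W (k(p := k p * ((1 - q {l, p} * k l) / (1 - k l))))"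
    using delta_leaf(2)[OF assms, of "\<lambda>v. - k v" q] unfolding Delta_eq_delta *[symmetric] by simp
qed

lemma Delta_cong: "(\<And>v. v \<in> U \<Longrightarrow> k v = k' v) \<Longrightarrow> Delta E q U k = Delta E q U k'"
  unfolding Delta_eq_delta by (rule delta_cong) simp

lemma Delta_fun_upd_scale:
  assumes "finite U" "p \<in> U"
  shows "Delta E q U (k(p := t * x)) = (1 - t) * Delta E q (U - {p}) k + t * Delta E q U (k(p := x))"
proof -
  have *: "(\<lambda>v. - (k(p := y)) v) = (\<lambda>v. - k v)(p := - y)" for y by auto
  show ?thesis
    using delta_fun_upd_scale[OF assms, of E q "\<lambda>v. - k v" t "- x"] unfolding Delta_eq_delta * by simp
qed

text \<open>The empty set contributes 1 and every other term is nonnegative;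
  \<open>{} \<notin> E\<close> ensures that the empty set carries no weight.\<close>

lemma delta_pos:
  assumes "finite U" "\<And>e. e \<in> E \<Longrightarrow> 0 \<le> q e" "{} \<notin> E" "\<And>v. v \<in> U \<Longrightarrow> 0 < k v"
  shows "0 < delta E q U k"
proof -
  have "0 \<le> edge_weight_prod E q W * prod k W" if "W \<in> Pow U" for W
    unfolding edge_weight_prod_def using that assms
    by (intro mult_nonneg_nonneg prod_nonneg) (auto intro: less_imp_le)
  moreover have "edge_weight_prod E q {} * prod k {} = 1"
    using assms(3) by (auto simp: edge_weight_prod_def intro!: prod.neutral)
  ultimately show ?thesis
    unfolding delta_def using assms(1) by (intro sum_pos2[of _ "{}"]) auto
qed

text \<open>Conditions for sets containing \<open>l\<close> turn, up to the positive factor 1 - y,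
  into those of the smaller tree at the scaled point. Two things remain: the scaled coordinate must
  again lie below 1, which is the condition for the set \<open>{p}\<close>, and sets without
  \<open>l\<close> impose their condition at the unscaled point, which follows by interpolation in
  coordinate \<open>p\<close>.\<close>

lemma TB_domain_leaf:
  assumes gU: "grown_tree U F" and pl: "p \<in> U" "l \<notin> U"
    and q: "q {l, p} < 1" and x: "x \<in> PiE U (\<lambda>_. UNIV)"
  shows "x(l := y) \<in> TB_domain (insert l U) (insert {l, p} F) q \<longleftrightarrow>
    0 < y \<and> y < 1 \<and> x(p := x p * ((1 - q {l, p} * y) / (1 - y))) \<in> TB_domain U F q"
proof (cases "0 < y \<and> y < 1")
  case False
  then show ?thesis by (auto simp: TB_domain_def PiE_iff)
next
  case y: True
  note F = grown_treeD[OF gU]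
  define s where "s = (1 - q {l, p} * y) / (1 - y)"
  \<comment> \<open>Weights below 1 make s > 1, so the unscaled coordinate lies between 0 and the
    scaled one.\<close>
  have "q {l, p} * y < 1 * y" using q y by (intro mult_strict_right_mono) auto
  then have s1: "1 < s" using y by (simp add: s_def)
  have pl': "p \<noteq> l" using pl by auto
  have D: "Delta (insert {l, p} F) q (insert l W) (x(l := y)) = (1 - y) * Delta F q W (x(p := x p * s))"
    if "W \<subseteq> U" for W
  proof -
    have "Delta F q W (x(l := y, p := x p * s)) = Delta F q W (x(p := x p * s))"
      using that pl by (intro Delta_cong) auto
    then show ?thesis
      using Delta_leaf(2)[OF gU pl that, of "x(l := y)" q] y pl' by (simp add: s_def)
  qed
  have D': "Delta (insert {l, p} F) q W (x(l := y)) = Delta F q W x" if "W \<subseteq> U" for W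

  proof -
    have "Delta F q W (x(l := y)) = Delta F q W x" using that pl by (intro Delta_cong) auto
    then show ?thesis using Delta_leaf(1)[OF gU pl that] by simp
  qed
  have xl: "x l = undefined" using x pl by auto
  show ?thesis
  proof (intro iffI conjI)
    assume k: "x(l := y) \<in> TB_domain (insert l U) (insert {l, p} F) q"
    then have x01: "x v \<in> {0<..<1}" if "v \<in> U" for v
      using that pl by (auto simp: TB_domain_def PiE_iff fun_upd_apply split: if_splits)
    have pos: "0 < Delta F q W (x(p := x p * s))" if "W \<subseteq> U" for W
    proof -
      have "0 < Delta (insert {l, p} F) q (insert l W) (x(l := y))"
        using k Set.insert_mono[OF that, of l] unfolding TB_domain_def by blast
      then show ?thesis using D[OF that] y by (simp add: zero_less_mult_iff)
    qed
    \<comment> \<open>No edge fits into a single vertex, so positivity at \<open>{p}\<close> is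
      exactly the upper bound on the scaled coordinate.\<close>
    have "Delta F q {p} (x(p := x p * s)) = 1 - x p * s"
    proof -
      have "{e \<in> F. e \<subseteq> {p}} = {}"
        using F(5) F(6)[of p] by (auto simp: subset_singleton_iff)
      then have "edge_weight_prod F q {p} = 1" "edge_weight_prod F q {} = 1"
        using F(5) by (auto simp: edge_weight_prod_def intro!: prod.neutral)
      then show ?thesis by (simp add: Delta_def Pow_insert)
    qed
    then have "x p * s < 1" using pos[of "{p}"] pl by simp
    moreover have "0 < x p * s" using x01[OF pl(1)] s1 by simp
    ultimately show "x(p := x p * ((1 - q {l, p} * y) / (1 - y))) \<in> TB_domain U F q"
      using pos x01 x pl by (auto simp: TB_domain_def s_def[symmetric] PiE_iff extensional_def)
  next
    assume "0 < y \<and> y < 1 \<and> x(p := x p * ((1 - q {l, p} * y) / (1 - y))) \<in> TB_domain U F q"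
    then have k: "x(p := x p * s) \<in> TB_domain U F q" by (simp add: s_def)
    then have pos: "0 < Delta F q W (x(p := x p * s))" if "W \<subseteq> U" for W
      using that by (auto simp: TB_domain_def)
    have x01: "x v \<in> {0<..<1}" if "v \<in> U" "v \<noteq> p" for v
      using k that by (auto simp: TB_domain_def PiE_iff fun_upd_apply split: if_splits)
    have xs: "x p * s \<in> {0<..<1}"
      using k pl by (auto simp: TB_domain_def PiE_iff fun_upd_apply split: if_splits)
    then have xp: "0 < x p" using s1 by (auto simp: zero_less_mult_iff)
    then have "x p * 1 < x p * s" using s1 by (intro mult_strict_left_mono) auto
    then have xp1: "x p < 1" using xs by simp
    have "0 < Delta F q W x" if W: "W \<subseteq> U" for W
    proof (cases "p \<in> W")
      case False
      then have "Delta F q W (x(p := x p * s)) = Delta F q W x" by (intro Delta_cong) auto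
      then show ?thesis using pos[OF W] by simp
    next
      case True
      \<comment> \<open>\<open>Delta\<close> is affine in \<open>x p\<close> and positive at the values \<open>0\<close> and \<open>x p * s\<close>, hence in between.\<close>
      have "x = x(p := (1 / s) * (x p * s))" using s1 by auto
      then have "Delta F q W x = Delta F q W (x(p := (1 / s) * (x p * s)))" by simp
      also have "\<dots> = (1 - 1 / s) * Delta F q (W - {p}) x + 1 / s * Delta F q W (x(p := x p * s))"
        using W F(1) True by (intro Delta_fun_upd_scale) (auto intro: finite_subset)
      also have "Delta F q (W - {p}) x = Delta F q (W - {p}) (x(p := x p * s))"
        by (intro Delta_cong) auto
      finally show ?thesis using s1 pos[OF W] pos[of "W - {p}"] W
        by (auto intro!: add_pos_pos mult_pos_pos simp del: fun_upd_apply)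
    qed
    moreover have "0 < Delta (insert {l, p} F) q W (x(l := y))" if W: "W \<subseteq> insert l U" "l \<in> W" for W
    proof -
      have "W - {l} \<subseteq> U" "insert l (W - {l}) = W" using W by auto
      then show ?thesis using D[of "W - {l}"] pos[of "W - {l}"] y by simp
    qed
    ultimately have "0 < Delta (insert {l, p} F) q W (x(l := y))" if W: "W \<subseteq> insert l U" for W
      using D'[of W] W by (cases "l \<in> W") (auto simp: subset_insert)
    then show "x(l := y) \<in> TB_domain (insert l U) (insert {l, p} F) q"
      using x01 xp xp1 x y by (auto simp: TB_domain_def PiE_iff extensional_def)
  qed (use y in auto)
qed

section \<open>Euler's integral\<close>

text \<open>Differentiation under the integral: on the convex ball the mean value inequality bounds
  the difference quotients by \<open>w\<close>, and dominated convergence applies along every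
  sequence tending to \<open>z0\<close>.\<close>

lemma has_field_derivative_integral:
  fixes f f' :: "complex \<Rightarrow> 'a \<Rightarrow> complex"
  assumes r: "0 < r"
    and int: "\<And>z. z \<in> ball z0 r \<Longrightarrow> integrable M (f z)"
    and meas: "f' z0 \<in> borel_measurable M"
    and deriv: "\<And>z t. z \<in> ball z0 r \<Longrightarrow> ((\<lambda>z. f z t) has_field_derivative f' z t) (at z)"
    and bound: "\<And>z t. z \<in> ball z0 r \<Longrightarrow> norm (f' z t) \<le> w t"
    and w: "integrable M w"
  shows "((\<lambda>z. \<integral>t. f z t \<partial>M) has_field_derivative (\<integral>t. f' z0 t \<partial>M)) (at z0)"
proof -
  have z0: "z0 \<in> ball z0 r" using r by simp
  have "((\<lambda>z. ((\<integral>t. f z t \<partial>M) - (\<integral>t. f z0 t \<partial>M)) / (z - z0)) \<longlongrightarrow> (\<integral>t. f' z0 t \<partial>M))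
          (at z0 within ball z0 r)"
    unfolding tendsto_at_iff_sequentially comp_def
  proof (intro allI impI)
    fix X assume X: "\<forall>n. X n \<in> ball z0 r - {z0}" and lim: "X \<longlonglongrightarrow> z0"
    have "(\<lambda>n. \<integral>t. (f (X n) t - f z0 t) / (X n - z0) \<partial>M) \<longlonglongrightarrow> (\<integral>t. f' z0 t \<partial>M)"
    proof (rule integral_dominated_convergence[OF meas _ w])
      show "(\<lambda>t. (f (X n) t - f z0 t) / (X n - z0)) \<in> borel_measurable M" for n
        using int[of "X n"] int[OF z0] X by (intro borel_measurable_divide borel_measurable_diff) auto
      show "AE t in M. (\<lambda>n. (f (X n) t - f z0 t) / (X n - z0)) \<longlonglongrightarrow> f' z0 t"
      proof (rule AE_I2)
        fix t
        have "((\<lambda>z. (f z t - f z0 t) / (z - z0)) \<longlongrightarrow> f' z0 t) (at z0)"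
          using deriv[OF z0, of t] by (simp add: has_field_derivative_iff)
        then show "(\<lambda>n. (f (X n) t - f z0 t) / (X n - z0)) \<longlonglongrightarrow> f' z0 t"
          using X lim by (auto simp: tendsto_at_iff_sequentially comp_def)
      qed
      show "AE t in M. norm ((f (X n) t - f z0 t) / (X n - z0)) \<le> w t" for n
      proof (rule AE_I2)
        fix t
        have Xn: "X n \<in> ball z0 r" using X by blast
        have "norm (f (X n) t - f z0 t) \<le> w t * norm (X n - z0)"
          by (rule field_differentiable_bound[OF convex_ball _ _ Xn z0, where f' = "\<lambda>z. f' z t"])
             (fact has_field_derivative_at_within[OF deriv] bound)+
        then show "norm ((f (X n) t - f z0 t) / (X n - z0)) \<le> w t"
          using X by (simp add: norm_divide divide_le_eq)
      qed
    qed
    moreover have "(\<integral>t. (f (X n) t - f z0 t) / (X n - z0) \<partial>M)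
        = ((\<integral>t. f (X n) t \<partial>M) - (\<integral>t. f z0 t \<partial>M)) / (X n - z0)" for n
      using int[of "X n"] int[OF z0] X by simp
    ultimately show "(\<lambda>n. ((\<integral>t. f (X n) t \<partial>M) - (\<integral>t. f z0 t \<partial>M)) / (X n - z0)) \<longlonglongrightarrow> (\<integral>t. f' z0 t \<partial>M)"
      by (simp only:)
  qed
  then show ?thesis
    unfolding has_field_derivative_iff at_within_open[OF z0 open_ball] .
qed

section \<open>The beta measure and its moments\<close>

text \<open>The unnormalised beta distribution. Absorbing the weight of Euler's integral into a
  finite measure leaves only (1 - z t)^(-a) as integrand, for which bounds suffice as long as z
  stays off the cut.\<close>

definition beta_measure :: "real \<Rightarrow> real \<Rightarrow> real measure" where
  "beta_measure b d =
     density lborel (\<lambda>t. ennreal (indicator {0<..<1} t * t powr (b - 1) * (1 - t) powr (d - 1)))"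

lemma space_beta_measure [simp]: "space (beta_measure b d) = UNIV"
  and sets_beta_measure [simp, measurable_cong]: "sets (beta_measure b d) = sets borel"
  by (simp_all add: beta_measure_def)

lemma nn_integral_beta_measure:
  assumes [measurable]: "f \<in> borel_measurable borel"
  shows "(\<integral>\<^sup>+t. f t \<partial>beta_measure b d) =
    (\<integral>\<^sup>+t. ennreal (indicator {0<..<1} t * t powr (b - 1) * (1 - t) powr (d - 1)) * f t \<partial>lborel)"
  unfolding beta_measure_def by (subst nn_integral_density) auto

lemma AE_beta_measure: "AE t in beta_measure b d. 0 < t \<and> t < 1"
  unfolding beta_measure_def by (subst AE_density) (auto intro!: AE_I2 simp: indicator_def split: if_splits)

lemma nn_integral_Beta:
  fixes b d :: real
  assumes "0 < b" "0 < d"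
  shows "(\<integral>\<^sup>+t. ennreal (indicator {0<..<1} t * t powr (b - 1) * (1 - t) powr (d - 1)) \<partial>lborel) =
    ennreal (Beta b d)"
proof -
  have "((\<lambda>t. t powr (b - 1) * (1 - t) powr (d - 1)) has_integral Beta b d) {0<..<1}"
    using has_integral_Beta_real[OF assms] by (simp add: has_integral_Icc_iff_Ioo)
  from nn_integral_has_integral_lebesgue[OF _ this] show ?thesis by (simp add: mult.assoc)
qed

text \<open>Extra powers just shift the parameters. Negative \<open>r\<close> is included because
  argument 1 leads to (1 - t)^(-a).\<close>

lemma nn_integral_beta_measure_powr:
  fixes b d :: real
  assumes "0 < b + s" "0 < d + r"
  shows "(\<integral>\<^sup>+t. ennreal (t powr s * (1 - t) powr r) \<partial>beta_measure b d) = ennreal (Beta (b + s) (d + r))"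
proof -
  have *: "indicator {0<..<1} t * t powr (b - 1) * (1 - t) powr (d - 1) * (t powr s * (1 - t) powr r) =
      indicator {0<..<1} t * t powr (b + s - 1) * (1 - t) powr (d + r - 1)" for t :: real
    using powr_add[of t s "b - 1"] powr_add[of "1 - t" r "d - 1"]
    by (simp add: indicator_def add_ac add_diff_eq)
  have "(\<integral>\<^sup>+t. ennreal (t powr s * (1 - t) powr r) \<partial>beta_measure b d) =
      (\<integral>\<^sup>+t. ennreal (indicator {0<..<1} t * t powr (b + s - 1) * (1 - t) powr (d + r - 1)) \<partial>lborel)"
    unfolding *[symmetric] by (subst nn_integral_beta_measure) (simp_all add: ennreal_mult')
  then show ?thesis unfolding nn_integral_Beta[OF assms] .
qed

text \<open>The quotient of Pochhammer symbols is what turns the binomial series, integrated term by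
  term, into the Gauss series.\<close>

lemma Beta_plus_nat:
  fixes b d :: real
  assumes "0 < b" "0 < d"
  shows "Beta (b + of_nat n) d = Beta b d * pochhammer b n / pochhammer (b + d) n"
proof -
  have *: "x \<notin> \<int>\<^sub>\<le>\<^sub>0" if "0 < x" for x :: real using that by (auto elim: nonpos_Ints_cases)
  have "Gamma (b + n) = pochhammer b n * Gamma b" "Gamma (b + d + n) = pochhammer (b + d) n * Gamma (b + d)"
    using assms *[of b] *[of "b + d"] Gamma_real_pos[of b] Gamma_real_pos[of "b + d"]
    by (simp_all add: pochhammer_Gamma less_imp_neq[symmetric])
  then show ?thesis by (simp add: Beta_def add_ac mult_ac)
qed

lemma
  assumes "0 < b" "0 < d"
  shows emeasure_beta_measure: "emeasure (beta_measure b d) UNIV = ennreal (Beta b d)"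
    and finite_measure_beta_measure: "finite_measure (beta_measure b d)"
    and Beta_real_pos: "0 < Beta b d"
proof -
  show pos: "0 < Beta b d" using assms by (simp add: Beta_def)
  \<comment> \<open>\<open>0 powr 0\<close> is 0, so this integrand equals 1 only off the endpoints;
    hence the almost-everywhere argument.\<close>
  have "(\<integral>\<^sup>+t. ennreal (t powr 0 * (1 - t) powr 0) \<partial>beta_measure b d) = (\<integral>\<^sup>+t. 1 \<partial>beta_measure b d)"
    by (intro nn_integral_cong_AE eventually_mono[OF AE_beta_measure]) auto
  then show *: "emeasure (beta_measure b d) UNIV = ennreal (Beta b d)"
    using nn_integral_beta_measure_powr[of b 0 d 0] assms by simp
  show "finite_measure (beta_measure b d)" by standard (simp add: *)
qed

text \<open>Composing with the retraction onto \<open>[0, 1]\<close>, which does not affect integrals against the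
  beta measure, makes the Euler integrand continuous in \<open>t\<close> on the whole line and bounded,
  locally uniformly in \<open>z\<close>.\<close>

definition clamp01 :: "real \<Rightarrow> real" where
  "clamp01 t = max 0 (min 1 t)"

lemma clamp01_bounds: "0 \<le> clamp01 t" "clamp01 t \<le> 1"
  and clamp01_eq: "0 \<le> t \<Longrightarrow> t \<le> 1 \<Longrightarrow> clamp01 t = t"
  and continuous_on_clamp01 [continuous_intros]: "continuous_on A g \<Longrightarrow> continuous_on A (\<lambda>x. clamp01 (g x))"
  and measurable_clamp01 [measurable]: "clamp01 \<in> borel_measurable borel"
  by (auto simp: clamp01_def[abs_def] intro!: continuous_intros)

section \<open>Holomorphy of the Euler integral on the cut plane\<close>

abbreviation cut_plane :: "complex set" where
  "cut_plane \<equiv> - (complex_of_real ` {1..})"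

lemma open_cut_plane: "open cut_plane"
proof -
  have "closed (complex_of_real ` {1..})"
    by (intro closed_injective_linear_image) (auto simp: linear_iff inj_on_def scaleR_conv_of_real)
  then show ?thesis by (rule open_Compl)
qed

text \<open>If 1 - z t = r with r at most 0, then z = (1 - r)/t is real and at least 1. So off the
  cut the base of the Euler integrand avoids the branch cut of the principal power, uniformly in
  t.\<close>

lemma one_minus_notin_nonpos_Reals:
  assumes "z \<in> cut_plane" "0 \<le> t" "t \<le> 1"
  shows "1 - z * complex_of_real t \<notin> \<real>\<^sub>\<le>\<^sub>0"
proof
  assume "1 - z * complex_of_real t \<in> \<real>\<^sub>\<le>\<^sub>0"
  then obtain r where r: "r \<le> 0" "1 - z * complex_of_real t = of_real r"
    by (auto elim: nonpos_Reals_cases)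
  then have zt: "z * of_real t = of_real (1 - r)" by (simp add: algebra_simps)
  with r have "t \<noteq> 0" by auto
  with zt have "z = of_real ((1 - r) / t)" by (simp add: field_simps)
  moreover have "1 \<le> (1 - r) / t" using r assms \<open>t \<noteq> 0\<close> by (simp add: le_divide_eq)
  ultimately have "z \<in> complex_of_real ` {1..}" by (intro image_eqI) auto
  then show False using assms by simp
qed

text \<open>The third hypergeometric parameter is b + d, and the factor 1 / Beta b d is left out;
  the value will be \<open>Beta b d\<close> times the Gauss function.\<close>

definition Euler_integral :: "real \<Rightarrow> real \<Rightarrow> real \<Rightarrow> complex \<Rightarrow> complex" where
  "Euler_integral a b d z =
     (\<integral>t. (1 - z * of_real (clamp01 t)) powr (- of_real a) \<partial>beta_measure b d)"

lemma continuous_on_Euler_integrand: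
  assumes "A \<subseteq> cut_plane"
  shows "continuous_on (A \<times> UNIV) (\<lambda>(z, t). (1 - z * of_real (clamp01 t)) powr s)"
proof -
  have "continuous_on (- \<real>\<^sub>\<le>\<^sub>0) (\<lambda>w::complex. w powr s)"
    by (intro holomorphic_on_imp_continuous_on holomorphic_intros) auto
  moreover have "continuous_on (A \<times> UNIV) (\<lambda>p. 1 - fst p * complex_of_real (clamp01 (snd p)))"
    by (intro continuous_intros)
  moreover have "(\<lambda>p. 1 - fst p * complex_of_real (clamp01 (snd p))) ` (A \<times> UNIV) \<subseteq> - \<real>\<^sub>\<le>\<^sub>0"
  proof (intro subsetI ComplI)
    fix w assume "w \<in> (\<lambda>p. 1 - fst p * complex_of_real (clamp01 (snd p))) ` (A \<times> UNIV)" "w \<in> \<real>\<^sub>\<le>\<^sub>0"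
    then obtain z t where "z \<in> A" "1 - z * complex_of_real (clamp01 t) \<in> \<real>\<^sub>\<le>\<^sub>0" by auto
    then show False using one_minus_notin_nonpos_Reals[of z "clamp01 t"] clamp01_bounds assms by blast
  qed
  ultimately show ?thesis unfolding case_prod_beta by (rule continuous_on_compose2)
qed

lemma borel_measurable_Euler_integrand:
  assumes "z \<in> cut_plane"
  shows "(\<lambda>t. (1 - z * of_real (clamp01 t)) powr s) \<in> borel_measurable borel"
proof (rule borel_measurable_continuous_onI)
  have "continuous_on UNIV ((\<lambda>(z, t). (1 - z * of_real (clamp01 t)) powr s) \<circ> (\<lambda>t. (z, t)))"
    by (intro continuous_on_compose continuous_intros continuous_on_subset[OF continuous_on_Euler_integrand[of "{z}"]])
       (use assms in auto)
  then show "continuous_on UNIV (\<lambda>t. (1 - z * of_real (clamp01 t)) powr s)"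
    by (simp add: comp_def)
qed

text \<open>The integrand is jointly continuous on the compact set K \<times> [0, 1], and clamping
  reduces every t to that interval.\<close>

lemma Euler_integrand_bounded:
  assumes "compact K" "K \<subseteq> cut_plane"
  obtains B where "\<And>z t. z \<in> K \<Longrightarrow> norm ((1 - z * of_real (clamp01 t)) powr s) \<le> B"
proof -
  let ?g = "\<lambda>(z, t). (1 - z * of_real (clamp01 t)) powr s"
  have "compact (?g ` (K \<times> {0..1}))"
    using assms by (intro compact_continuous_image compact_Times
        continuous_on_subset[OF continuous_on_Euler_integrand[of K]]) auto
  then obtain B where B: "\<And>y. y \<in> ?g ` (K \<times> {0..1}) \<Longrightarrow> norm y \<le> B"
    using compact_imp_bounded bounded_iff by metis
  show thesis
  proof (rule that)
    fix z t assume "z \<in> K"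
    then have "?g (z, clamp01 t) \<in> ?g ` (K \<times> {0..1})" using clamp01_bounds by (intro imageI) auto
    then show "norm ((1 - z * of_real (clamp01 t)) powr s) \<le> B"
      using B[of "?g (z, clamp01 t)"] by (simp add: clamp01_eq clamp01_bounds)
  qed
qed

lemma integrable_Euler_integrand:
  assumes "0 < b" "0 < d" "z \<in> cut_plane"
  shows "integrable (beta_measure b d) (\<lambda>t. (1 - z * of_real (clamp01 t)) powr s)"
proof -
  interpret finite_measure "beta_measure b d" using finite_measure_beta_measure assms by blast
  obtain B where "\<And>y t. y \<in> {z} \<Longrightarrow> norm ((1 - y * of_real (clamp01 t)) powr s) \<le> B"
    using Euler_integrand_bounded[of "{z}" s] assms by auto
  then show ?thesis
    using borel_measurable_Euler_integrand[OF assms(3)] by (intro integrable_const_bound[where B = B]) (auto simp: measurable_def)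
qed

lemma holomorphic_Euler_integral:
  assumes "0 < b" "0 < d"
  shows "Euler_integral a b d holomorphic_on cut_plane"
proof -
  interpret finite_measure "beta_measure b d" using finite_measure_beta_measure assms by blast
  have "Euler_integral a b d field_differentiable (at z0)" if z0: "z0 \<in> cut_plane" for z0
  proof -
    \<comment> \<open>A closed disc is compact, so the differentiated integrand has a single bound
      there; as the measure is finite, that constant can serve as dominating function.\<close>
    obtain r where r: "0 < r" "cball z0 r \<subseteq> cut_plane"
      using open_contains_cball open_cut_plane z0 by blast
    define f' :: "complex \<Rightarrow> real \<Rightarrow> complex"
      where "f' = (\<lambda>z t. of_real a * of_real (clamp01 t) * (1 - z * of_real (clamp01 t)) powr (- of_real a - 1))"
    obtain B where B: "\<And>z t. z \<in> cball z0 r \<Longrightarrow> norm ((1 - z * of_real (clamp01 t)) powr (- of_real a - 1)) \<le> B"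
      using Euler_integrand_bounded[of "cball z0 r"] r by auto
    have "((\<lambda>z. \<integral>t. (1 - z * of_real (clamp01 t)) powr (- of_real a) \<partial>beta_measure b d)
        has_field_derivative (\<integral>t. f' z0 t \<partial>beta_measure b d)) (at z0)"
    proof (rule has_field_derivative_integral[OF r(1), where w = "\<lambda>_. \<bar>a\<bar> * B"])
      show "integrable (beta_measure b d) (\<lambda>t. (1 - z * of_real (clamp01 t)) powr (- of_real a))"
        if "z \<in> ball z0 r" for z
        using that r(2) assms ball_subset_cball by (intro integrable_Euler_integrand) blast+
      show "f' z0 \<in> borel_measurable (beta_measure b d)"
        unfolding f'_def using borel_measurable_Euler_integrand[OF z0] by measurable
      fix z t assume z: "z \<in> ball z0 r"
      then have "z \<in> cut_plane" using r(2) ball_subset_cball by blast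
      then have "1 - z * of_real (clamp01 t) \<notin> \<real>\<^sub>\<le>\<^sub>0"
        by (intro one_minus_notin_nonpos_Reals clamp01_bounds)
      then show "((\<lambda>z. (1 - z * of_real (clamp01 t)) powr (- of_real a)) has_field_derivative f' z t) (at z)"
        unfolding f'_def by (auto intro!: derivative_eq_intros)
      have "norm (f' z t) = \<bar>a\<bar> * clamp01 t * norm ((1 - z * of_real (clamp01 t)) powr (- of_real a - 1))"
        using clamp01_bounds[of t] by (simp add: f'_def norm_mult)
      also have "\<dots> \<le> \<bar>a\<bar> * 1 * B"
        using z clamp01_bounds[of t] by (intro mult_mono B) auto
      finally show "norm (f' z t) \<le> \<bar>a\<bar> * B" by simp
    qed simp
    then show ?thesis
      by (auto simp: field_differentiable_def Euler_integral_def[abs_def])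
  qed
  then show ?thesis
    by (auto simp: holomorphic_on_def intro: field_differentiable_at_within)
qed

lemma integral_beta_measure_power:
  assumes "0 < b" "0 < d"
  shows "(\<integral>\<^sup>+t. ennreal (clamp01 t ^ n) \<partial>beta_measure b d) = ennreal (Beta (b + of_nat n) d)"
    and "(\<integral>t. clamp01 t ^ n \<partial>beta_measure b d) = Beta (b + of_nat n) d"
proof -
  have "(\<integral>\<^sup>+t. ennreal (clamp01 t ^ n) \<partial>beta_measure b d) =
      (\<integral>\<^sup>+t. ennreal (t powr of_nat n * (1 - t) powr 0) \<partial>beta_measure b d)"
    by (intro nn_integral_cong_AE eventually_mono[OF AE_beta_measure])
       (auto simp: powr_realpow clamp01_eq)
  also have "\<dots> = ennreal (Beta (b + of_nat n) d)"
    using nn_integral_beta_measure_powr[of b "of_nat n" d 0] assms by simp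
  finally show *: "(\<integral>\<^sup>+t. ennreal (clamp01 t ^ n) \<partial>beta_measure b d) = ennreal (Beta (b + of_nat n) d)" .
  show "(\<integral>t. clamp01 t ^ n \<partial>beta_measure b d) = Beta (b + of_nat n) d"
    using * assms Beta_real_pos[of "b + of_nat n" d] clamp01_bounds
    by (subst integral_eq_nn_integral) auto
qed

section \<open>From the binomial series to the Gauss series\<close>

text \<open>The sign (-1)^n of the binomial coefficient cancels the one of (-z)^n; this brings the
  binomial series of (1 - z)^(-a) into Pochhammer form.\<close>

lemma gbinomial_minus_mult_power:
  fixes a z :: "'a :: field_char_0"
  shows "((- a) gchoose n) * (- z) ^ n = pochhammer a n / fact n * z ^ n"
proof -
  have "((- a) gchoose n) * (- z) ^ n = ((-1) ^ n * (-1) ^ n) * (pochhammer a n / fact n * z ^ n)"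
    unfolding gbinomial_pochhammer power_minus[of z] minus_minus by (simp only: times_divide_eq_left times_divide_eq_right mult_ac)
  then show ?thesis by (simp only: power_add[symmetric] mult_2[symmetric] power_mult) simp
qed

lemma pochhammer_series:
  fixes a :: real
  assumes "norm x < 1"
  shows "(\<lambda>n. pochhammer a n / fact n * x ^ n) sums (1 - x) powr (- a)"
  using gen_binomial_real[of "- x" "- a"] assms by (simp only: gbinomial_minus_mult_power) simp

lemma pochhammer_series_complex:
  fixes a z :: complex
  assumes "norm z < 1"
  shows "(\<lambda>n. pochhammer a n / fact n * z ^ n) sums (1 - z) powr (- a)"
  using gen_binomial_complex[of "- z" "- a"] assms by (simp only: gbinomial_minus_mult_power) simp

lemma hypergeo_nth:
  "fps_nth (fps_hypergeo [a, b] [c] 1) n = pochhammer a n * pochhammer b n / (pochhammer c n * fact n)"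
  by simp

text \<open>Expand (1 - z t)^(-a) by the binomial series and integrate term by term. Since t is
  clamped to [0, 1] and a is positive, the n-th term is bounded by the n-th term of the series at
  |z| < 1, which converges. The moments of the beta measure supply the remaining Pochhammer
  symbols.\<close>

lemma Euler_integral_ball:
  assumes pos: "0 < a" "0 < b" "0 < d" and z: "norm z < 1"
  shows "Euler_integral a b d z =
    of_real (Beta b d) * eval_fps (fps_hypergeo [of_real a, of_real b] [of_real (b + d)] 1) z"
proof -
  interpret finite_measure "beta_measure b d" using finite_measure_beta_measure pos by blast
  let ?M = "beta_measure b d"
  define c :: "nat \<Rightarrow> complex" where "c = (\<lambda>n. pochhammer (of_real a) n / fact n)"
  define f where "f = (\<lambda>n t. c n * z ^ n * of_real (clamp01 t ^ n))"
  have c_nonneg: "0 \<le> pochhammer a n / fact n" for n using pos by (simp add: pochhammer_nonneg)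
  have c: "c n = of_real (pochhammer a n / fact n)" for n by (simp add: c_def pochhammer_of_real)
  have nf: "norm (f n t) = pochhammer a n / fact n * norm z ^ n * clamp01 t ^ n" for n t
    using pochhammer_nonneg[of a n] pos clamp01_bounds[of t]
    unfolding f_def c by (simp add: norm_mult norm_power norm_divide)
  have nf': "norm (f n t) \<le> pochhammer a n / fact n * norm z ^ n" for n t
  proof -
    have "clamp01 t ^ n \<le> 1" using clamp01_bounds[of t] by (intro power_le_one) auto
    then show ?thesis unfolding nf by (intro mult_left_le mult_nonneg_nonneg c_nonneg) auto
  qed
  have summ: "summable (\<lambda>n. pochhammer a n / fact n * norm z ^ n)"
    by (rule sums_summable[OF pochhammer_series[of "norm z" a]]) (use z in simp)
  have meas: "f n \<in> borel_measurable ?M" for n unfolding f_def by measurable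
  have int: "integrable ?M (f n)" for n
    by (rule integrable_const_bound[OF AE_I2[OF nf'] meas])
  have sumf: "(\<Sum>n. f n t) = (1 - z * of_real (clamp01 t)) powr (- of_real a)" for t
  proof -
    have "norm (z * of_real (clamp01 t)) \<le> norm z * 1"
      unfolding norm_mult using clamp01_bounds[of t] by (intro mult_left_mono) auto
    then have "(\<lambda>n. c n * (z * of_real (clamp01 t)) ^ n) sums (1 - z * of_real (clamp01 t)) powr (- of_real a)"
      unfolding c_def using z by (intro pochhammer_series_complex) simp
    then show ?thesis by (simp add: f_def power_mult_distrib mult_ac sums_iff)
  qed
  have "(\<lambda>n. \<integral>t. f n t \<partial>?M) sums (\<integral>t. (\<Sum>n. f n t) \<partial>?M)"
  proof (rule sums_integral[OF int])
    show "AE t in ?M. summable (\<lambda>n. norm (f n t))"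
      by (intro AE_I2 summable_comparison_test'[OF summ, of 0]) (use nf' in auto)
    have "(\<integral>t. norm (f n t) \<partial>?M) \<le> (\<integral>t. pochhammer a n / fact n * norm z ^ n \<partial>?M)" for n
      using int nf' by (intro integral_mono) auto
    then have "norm (\<integral>t. norm (f n t) \<partial>?M) \<le> measure ?M UNIV * (pochhammer a n / fact n * norm z ^ n)" for n
      by (simp add: mult_ac)
    then show "summable (\<lambda>n. \<integral>t. norm (f n t) \<partial>?M)"
      by (intro summable_comparison_test'[OF summable_mult[OF summ]])
  qed
  moreover have "(\<integral>t. f n t \<partial>?M) = of_real (Beta b d) *
      (fps_nth (fps_hypergeo [of_real a, of_real b] [of_real (b + d)] 1) n * z ^ n)" for n
  proof -
    have "(\<integral>t. f n t \<partial>?M) = c n * z ^ n * of_real (\<integral>t. clamp01 t ^ n \<partial>?M)"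
      unfolding f_def integral_complex_of_real[symmetric] by (rule integral_mult_right_zero)
    also have "\<dots> = of_real (Beta b d) *
      (fps_nth (fps_hypergeo [of_real a, of_real b] [of_real (b + d)] 1) n * z ^ n)"
      unfolding integral_beta_measure_power(2)[OF pos(2,3)] Beta_plus_nat[OF pos(2,3)] hypergeo_nth
      by (simp add: c_def pochhammer_of_real mult_ac del: of_real_add)
    finally show ?thesis .
  qed
  ultimately have "(\<lambda>n. of_real (Beta b d) *
      (fps_nth (fps_hypergeo [of_real a, of_real b] [of_real (b + d)] 1) n * z ^ n)) sums
      Euler_integral a b d z"
    unfolding Euler_integral_def sumf by (simp only:)
  moreover have nz: "complex_of_real (Beta b d) \<noteq> 0" using Beta_real_pos[of b d] pos by simp
  ultimately have "(\<lambda>n. fps_nth (fps_hypergeo [of_real a, of_real b] [of_real (b + d)] 1) n * z ^ n) sums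
      (Euler_integral a b d z / of_real (Beta b d))"
    by (rule sums_mult_D)
  then have "eval_fps (fps_hypergeo [of_real a, of_real b] [of_real (b + d)] 1) z =
      Euler_integral a b d z / of_real (Beta b d)"
    unfolding eval_fps_def by (rule sums_unique[symmetric])
  then show ?thesis using nz by (simp only: times_divide_eq_right nonzero_mult_div_cancel_left not_False_eq_True)
qed

lemma one_minus_mult_clamp01_pos:
  assumes "x < 1"
  shows "0 < 1 - x * clamp01 t"
proof (cases "x \<le> 0")
  case True
  then have "x * clamp01 t \<le> 0" using clamp01_bounds by (simp add: mult_nonpos_nonneg)
  then show ?thesis by simp
next
  case False
  then have "x * clamp01 t \<le> x * 1" using clamp01_bounds by (intro mult_left_mono) auto
  then show ?thesis using assms by simp
qed

text \<open>The Euler integral divided by \<open>Beta b d\<close> is holomorphic on the cut plane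
  and agrees with the Gauss series on the disc, so it is the continuation by which
  \<open>hyp2F1\<close> is defined.\<close>

lemma nn_integral_Euler_less_1:
  assumes pos: "0 < a" "0 < b" "0 < d" and x: "x < 1"
  shows "(\<integral>\<^sup>+t. ennreal ((1 - x * t) powr (- a)) \<partial>beta_measure b d) =
    ennreal (Beta b d * hyp2F1 a b (b + d) x)"
proof -
  let ?M = "beta_measure b d" and ?g = "\<lambda>t. (1 - x * clamp01 t) powr (- a)"
  \<comment> \<open>For real x < 1 the base is positive, so the principal complex power is the real
    one.\<close>
  have eq: "(1 - complex_of_real x * of_real (clamp01 t)) powr (- of_real a) = of_real (?g t)" for t
    using powr_of_real[of "1 - x * clamp01 t" "- a"] one_minus_mult_clamp01_pos[OF x, of t] by simp
  have "complex_of_real x \<in> cut_plane" using x by auto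
  from integrable_Euler_integrand[OF pos(2,3) this, of "- of_real a"]
  have int: "integrable ?M ?g" unfolding eq complex_of_real_integrable_eq .
  have nz: "Beta b d \<noteq> 0" using Beta_real_pos[OF pos(2,3)] by simp
  have "hyp2F1 a b (b + d) x = Re (Euler_integral a b d (of_real x) / of_real (Beta b d))"
  proof (rule hyp2F1_eqI[OF _ _ x])
    show "(\<lambda>z. Euler_integral a b d z / of_real (Beta b d)) holomorphic_on cut_plane"
      using nz by (intro holomorphic_intros holomorphic_Euler_integral pos) auto
    show "Euler_integral a b d z / of_real (Beta b d) =
        eval_fps (fps_hypergeo [of_real a, of_real b] [of_real (b + d)] 1) z" if "z \<in> ball 0 1" for z
      using Euler_integral_ball[OF pos, of z] that nz by simp
  qed
  also have "Euler_integral a b d (of_real x) = of_real (\<integral>t. ?g t \<partial>?M)"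
    unfolding Euler_integral_def eq by (rule integral_complex_of_real)
  finally have h: "Beta b d * hyp2F1 a b (b + d) x = (\<integral>t. ?g t \<partial>?M)"
    using nz by simp
  have "(\<integral>\<^sup>+t. ennreal ((1 - x * t) powr (- a)) \<partial>?M) = (\<integral>\<^sup>+t. ennreal (?g t) \<partial>?M)"
    by (intro nn_integral_cong_AE eventually_mono[OF AE_beta_measure]) (auto simp: clamp01_eq)
  also have "\<dots> = ennreal (\<integral>t. ?g t \<partial>?M)"
    by (intro nn_integral_eq_integral int) simp
  finally show ?thesis unfolding h .
qed

text \<open>At argument 1 the integrand is unbounded near t = 1 and the domination used on the disc
  fails. For positive a all binomial coefficients are nonnegative, so sum and integral may still be
  exchanged in \<open>ennreal\<close>.\<close>

lemma nn_integral_Euler_1: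
  assumes pos: "0 < a" "0 < b" "a < d"
  shows "(\<integral>\<^sup>+t. ennreal ((1 - t) powr (- a)) \<partial>beta_measure b d) =
    ennreal (Beta b d * hyp2F1 a b (b + d) 1)"
proof -
  let ?M = "beta_measure b d"
  have d: "0 < d" using pos by simp
  define c where "c = (\<lambda>n. pochhammer a n / fact n)"
  define h where "h = (\<lambda>n. fps_nth (fps_hypergeo [a, b] [b + d] 1) n)"
  have c: "0 \<le> c n" for n using pos by (simp add: c_def pochhammer_nonneg)
  have h: "0 \<le> h n" for n unfolding h_def hypergeo_nth using pos d by (simp add: pochhammer_nonneg)
  have "(\<integral>\<^sup>+t. ennreal ((1 - t) powr (- a)) \<partial>?M) = (\<integral>\<^sup>+t. (\<Sum>n. ennreal (c n * clamp01 t ^ n)) \<partial>?M)"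
  proof (intro nn_integral_cong_AE eventually_mono[OF AE_beta_measure])
    fix t :: real assume t: "0 < t \<and> t < 1"
    then have "(\<lambda>n. c n * clamp01 t ^ n) sums (1 - t) powr (- a)"
      using pochhammer_series[of t a] by (simp add: c_def clamp01_eq)
    then show "ennreal ((1 - t) powr (- a)) = (\<Sum>n. ennreal (c n * clamp01 t ^ n))"
      by (rule suminf_ennreal_eq[symmetric, rotated])
         (intro mult_nonneg_nonneg c zero_le_power clamp01_bounds)
  qed
  also have "\<dots> = (\<Sum>n. \<integral>\<^sup>+t. ennreal (c n * clamp01 t ^ n) \<partial>?M)"
    by (intro nn_integral_suminf) measurable
  also have "\<dots> = (\<Sum>n. ennreal (Beta b d * h n))"
  proof (rule suminf_cong)
    fix n
    have "(\<integral>\<^sup>+t. ennreal (c n * clamp01 t ^ n) \<partial>?M) = ennreal (c n) * ennreal (Beta (b + of_nat n) d)"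
      unfolding integral_beta_measure_power(1)[OF pos(2) d, symmetric]
      using c by (subst nn_integral_cmult[symmetric]) (auto simp: ennreal_mult')
    also have "\<dots> = ennreal (c n * Beta (b + of_nat n) d)" using c by (simp add: ennreal_mult')
    also have "c n * Beta (b + of_nat n) d = Beta b d * h n"
      unfolding h_def hypergeo_nth Beta_plus_nat[OF pos(2) d] by (simp add: c_def mult_ac)
    finally show "(\<integral>\<^sup>+t. ennreal (c n * clamp01 t ^ n) \<partial>?M) = ennreal (Beta b d * h n)" .
  qed
  finally have eq: "(\<integral>\<^sup>+t. ennreal ((1 - t) powr (- a)) \<partial>?M) = (\<Sum>n. ennreal (Beta b d * h n))" .
  \<comment> \<open>The integral is Beta(b, d - a), finite because a < d. This makes the Gauss
    series summable at 1, so that its \<open>suminf\<close> is a genuine sum.\<close>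
  have "(\<integral>\<^sup>+t. ennreal ((1 - t) powr (- a)) \<partial>?M) = (\<integral>\<^sup>+t. ennreal (t powr 0 * (1 - t) powr (- a)) \<partial>?M)"
    by (intro nn_integral_cong_AE eventually_mono[OF AE_beta_measure]) auto
  also have "\<dots> < \<top>" using nn_integral_beta_measure_powr[of b 0 d "- a"] pos by simp
  finally have fin: "(\<Sum>n. ennreal (Beta b d * h n)) \<noteq> \<top>" unfolding eq by simp
  have B: "0 < Beta b d" using Beta_real_pos[OF pos(2) d] .
  have nonneg: "0 \<le> Beta b d * h n" for n using B h[of n] by simp
  have sB: "summable (\<lambda>n. Beta b d * h n)" using fin nonneg by (rule summable_suminf_not_top[rotated])
  then have s: "summable h" using B by (simp add: summable_cmult_iff)
  have "hyp2F1 a b (b + d) 1 = (\<Sum>n. h n)" unfolding hyp2F1_def eval_fps_def h_def by simp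
  then have "Beta b d * hyp2F1 a b (b + d) 1 = (\<Sum>n. Beta b d * h n)" using suminf_mult[OF s] by simp
  then show ?thesis unfolding eq using suminf_ennreal2[OF nonneg sB] by simp
qed

text \<open>The sign of \<open>hyp2F1\<close> is not visible from its definition. As
  \<open>ennreal\<close> sends negative numbers to 0, a value that is not positive would make the
  Euler integral vanish, although its integrand is positive almost everywhere for a measure of
  positive mass.\<close>

lemma
  assumes pos: "0 < a" "0 < b" "b < c" and x: "x < 1 \<or> x = 1 \<and> a + b < c"
  shows nn_integral_Euler: "(\<integral>\<^sup>+t. ennreal (indicator {0<..<1} t * t powr (b - 1) * (1 - t) powr (c - b - 1) *
           (1 - x * t) powr (- a)) \<partial>lborel) = ennreal (Beta b (c - b) * hyp2F1 a b c x)"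
    and hyp2F1_pos: "0 < hyp2F1 a b c x"
proof -
  let ?M = "beta_measure b (c - b)"
  have B: "0 < Beta b (c - b)" using pos by (intro Beta_real_pos) auto
  have eq: "(\<integral>\<^sup>+t. ennreal ((1 - x * t) powr (- a)) \<partial>?M) = ennreal (Beta b (c - b) * hyp2F1 a b c x)"
    using nn_integral_Euler_less_1[of a b "c - b" x] nn_integral_Euler_1[of a b "c - b"] pos x by auto
  then show "(\<integral>\<^sup>+t. ennreal (indicator {0<..<1} t * t powr (b - 1) * (1 - t) powr (c - b - 1) *
           (1 - x * t) powr (- a)) \<partial>lborel) = ennreal (Beta b (c - b) * hyp2F1 a b c x)"
    by (subst (asm) nn_integral_beta_measure) (auto simp: ennreal_mult'[symmetric])
  show "0 < hyp2F1 a b c x"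
  proof (rule ccontr)
    assume "\<not> 0 < hyp2F1 a b c x"
    then have "(\<integral>\<^sup>+t. ennreal ((1 - x * t) powr (- a)) \<partial>?M) = 0"
      unfolding eq using B by (simp add: ennreal_eq_0_iff mult_nonneg_nonpos)
    then have "AE t in ?M. ennreal ((1 - x * t) powr (- a)) = 0"
      by (subst (asm) nn_integral_0_iff_AE) auto
    then have "AE t in ?M. False"
    proof (rule eventually_mono[OF eventually_conj[OF _ AE_beta_measure]])
      fix t assume *: "ennreal ((1 - x * t) powr (- a)) = 0 \<and> 0 < t \<and> t < 1"
      have "x * t \<le> 1 * t" using x * by (intro mult_right_mono) auto
      then have "x * t < 1" using * by linarith
      then have "0 < (1 - x * t) powr (- a)" by simp
      then show False using * by (simp add: ennreal_eq_0_iff)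
    qed
    then have "emeasure ?M UNIV = 0" by (subst (asm) AE_iff_measurable[OF _ refl]) auto
    then show False using emeasure_beta_measure[of b "c - b"] pos B by simp
  qed
qed

section \<open>Integrating out a leaf\<close>

text \<open>Isolate coordinate \<open>p\<close> by Fubini and substitute in one real
  variable.\<close>

lemma nn_integral_PiM_scale:
  fixes f :: "('v \<Rightarrow> real) \<Rightarrow> ennreal"
  assumes U: "finite U" "p \<in> U" and s: "0 < s"
    and f[measurable]: "f \<in> borel_measurable (Pi\<^sub>M U (\<lambda>_. lborel))"
  shows "(\<integral>\<^sup>+x. f (x(p := x p * s)) \<partial>Pi\<^sub>M U (\<lambda>_. lborel)) =
    ennreal (1 / s) * (\<integral>\<^sup>+x. f x \<partial>Pi\<^sub>M U (\<lambda>_. lborel))"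
proof -
  interpret product_sigma_finite "\<lambda>_::'v. lborel :: real measure" by standard
  let ?P = "\<lambda>I. Pi\<^sub>M I (\<lambda>_::'v. lborel :: real measure)"
  define U' where "U' = U - {p}"
  have U': "finite U'" "p \<notin> U'" "U = insert p U'" using U by (auto simp: U'_def)
  have [measurable]: "(\<lambda>x. x p * s) \<in> borel_measurable (?P U)"
    using U measurable_component_singleton[of p U "\<lambda>_. lborel"] by simp
  have "(\<lambda>x. x(p := x p * s)) \<in> ?P U \<rightarrow>\<^sub>M ?P U"
    by (rule measurable_fun_upd[where J = U]) (use U in auto)
  then have fs: "(\<lambda>x. f (x(p := x p * s))) \<in> borel_measurable (?P U)" by measurable
  have inner: "(\<integral>\<^sup>+y. f (x(p := y * s)) \<partial>lborel) = ennreal (1 / s) * (\<integral>\<^sup>+y. f (x(p := y)) \<partial>lborel)"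
    if "x \<in> space (?P U')" for x
  proof -
    have "(\<lambda>y. x(p := y)) \<in> lborel \<rightarrow>\<^sub>M ?P U"
      by (rule measurable_fun_upd[where J = U']) (use U' that in auto)
    then have m: "(\<lambda>y. f (x(p := y))) \<in> borel_measurable borel" by measurable
    show ?thesis
      using s by (subst nn_integral_real_affine[OF m, of s 0])
        (auto simp: mult.assoc[symmetric] ennreal_mult'[symmetric] mult.commute)
  qed
  have split: "(\<integral>\<^sup>+x. h x \<partial>?P U) = (\<integral>\<^sup>+x. \<integral>\<^sup>+y. h (x(p := y)) \<partial>lborel \<partial>?P U')"
    if "h \<in> borel_measurable (?P U)" for h
    using product_nn_integral_insert[OF U'(1,2), of h] that U'(3) by simp
  have "(\<lambda>(x, y). x(p := y)) \<in> ?P U' \<Otimes>\<^sub>M lborel \<rightarrow>\<^sub>M ?P U"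
    using measurable_add_dim[of p U' "\<lambda>_. lborel"] U'(3) by simp
  then have meas: "(\<lambda>x. \<integral>\<^sup>+y. f (x(p := y)) \<partial>lborel) \<in> borel_measurable (?P U')" by measurable
  have "(\<integral>\<^sup>+x. f (x(p := x p * s)) \<partial>?P U) = (\<integral>\<^sup>+x. \<integral>\<^sup>+y. f (x(p := y * s)) \<partial>lborel \<partial>?P U')"
    unfolding split[OF fs] by simp
  also have "\<dots> = (\<integral>\<^sup>+x. ennreal (1 / s) * (\<integral>\<^sup>+y. f (x(p := y)) \<partial>lborel) \<partial>?P U')"
    by (intro nn_integral_cong inner)
  also have "\<dots> = ennreal (1 / s) * (\<integral>\<^sup>+x. f x \<partial>?P U)"
    unfolding split[OF f] by (rule nn_integral_cmult[OF meas])
  finally show ?thesis .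
qed

text \<open>The step common to both families: \<open>g\<close> collects what depends on the leaf
  coordinate alone, and dividing by \<open>s\<close> accounts for the Jacobian. Positivity of
  \<open>s\<close> is required only where \<open>g\<close> does not vanish; in the first family
  \<open>s\<close> can be negative for y > 1.\<close>

lemma nn_integral_PiM_leaf:
  fixes fV fU :: "('v \<Rightarrow> real) \<Rightarrow> real" and g s :: "real \<Rightarrow> real"
  assumes U: "finite U" "p \<in> U" "l \<notin> U"
    and fV: "fV \<in> borel_measurable (Pi\<^sub>M (insert l U) (\<lambda>_. lborel))"
    and fU: "fU \<in> borel_measurable (Pi\<^sub>M U (\<lambda>_. lborel))"
    and g: "\<And>y. 0 \<le> g y" "g \<in> borel_measurable borel"
    and s: "\<And>y. g y \<noteq> 0 \<Longrightarrow> 0 < s y" "s \<in> borel_measurable borel"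
    and eq: "\<And>x y. x \<in> PiE U (\<lambda>_. UNIV) \<Longrightarrow> fV (x(l := y)) = g y * fU (x(p := x p * s y))"
  shows "(\<integral>\<^sup>+x. ennreal (fV x) \<partial>Pi\<^sub>M (insert l U) (\<lambda>_. lborel)) =
    (\<integral>\<^sup>+y. ennreal (g y / s y) \<partial>lborel) * (\<integral>\<^sup>+x. ennreal (fU x) \<partial>Pi\<^sub>M U (\<lambda>_. lborel))"
proof -
  interpret product_sigma_finite "\<lambda>_::'v. lborel :: real measure" by standard
  let ?I = "\<integral>\<^sup>+x. ennreal (fU x) \<partial>Pi\<^sub>M U (\<lambda>_. lborel)"
  have inner: "(\<integral>\<^sup>+x. ennreal (fV (x(l := y))) \<partial>Pi\<^sub>M U (\<lambda>_. lborel)) = ennreal (g y / s y) * ?I" for y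
  proof (cases "g y = 0")
    case True
    have "(\<integral>\<^sup>+x. ennreal (fV (x(l := y))) \<partial>Pi\<^sub>M U (\<lambda>_. lborel)) = (\<integral>\<^sup>+x. 0 \<partial>Pi\<^sub>M U (\<lambda>_. lborel :: real measure))"
      by (rule nn_integral_cong) (simp add: eq space_PiM True)
    then show ?thesis using True by simp
  next
    case False
    have m: "(\<lambda>x. ennreal (fU x)) \<in> borel_measurable (Pi\<^sub>M U (\<lambda>_. lborel))" using fU by measurable
    have "(\<integral>\<^sup>+x. ennreal (fV (x(l := y))) \<partial>Pi\<^sub>M U (\<lambda>_. lborel)) =
        (\<integral>\<^sup>+x. ennreal (g y * s y / s y) * ennreal (fU (x(p := x p * s y))) \<partial>Pi\<^sub>M U (\<lambda>_. lborel))"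
      by (rule nn_integral_cong) (use g(1)[of y] s(1)[OF False] in \<open>simp add: eq space_PiM ennreal_mult'\<close>)
    also have "\<dots> = ennreal (g y * s y / s y) * (ennreal (1 / s y) * ?I)"
    proof (subst nn_integral_cmult)
      have "(\<lambda>x. x(p := x p * s y)) \<in> Pi\<^sub>M U (\<lambda>_. lborel) \<rightarrow>\<^sub>M Pi\<^sub>M U (\<lambda>_. lborel)"
        using U measurable_component_singleton[of p U "\<lambda>_. lborel :: real measure"]
        by (intro measurable_fun_upd[where J = U]) auto
      then show "(\<lambda>x. ennreal (fU (x(p := x p * s y)))) \<in> borel_measurable (Pi\<^sub>M U (\<lambda>_. lborel))"
        using m by (rule measurable_compose)
    qed (simp only: nn_integral_PiM_scale[OF U(1,2) s(1)[OF False] m])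
    also have "\<dots> = ennreal (g y / s y) * ?I"
      using g(1)[of y] s(1)[OF False] by (simp add: mult.assoc[symmetric] ennreal_mult'[symmetric])
    finally show ?thesis .
  qed
  \<comment> \<open>The leaf coordinate goes outermost, so that the scale \<open>s y\<close> is
    constant in the inner integral.\<close>
  have "(\<integral>\<^sup>+x. ennreal (fV x) \<partial>Pi\<^sub>M (insert l U) (\<lambda>_. lborel)) =
      (\<integral>\<^sup>+y. (\<integral>\<^sup>+x. ennreal (fV (x(l := y))) \<partial>Pi\<^sub>M U (\<lambda>_. lborel)) \<partial>lborel)"
    using U fV by (intro product_nn_integral_insert_rev) auto
  also have "\<dots> = (\<integral>\<^sup>+y. ennreal (g y / s y) * ?I \<partial>lborel)" unfolding inner ..
  also have "\<dots> = (\<integral>\<^sup>+y. ennreal (g y / s y) \<partial>lborel) * ?I"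
  proof (rule nn_integral_multc)
    note [measurable] = g(2) s(2)
    show "(\<lambda>y. ennreal (g y / s y)) \<in> borel_measurable lborel" by measurable
  qed
  finally show ?thesis .
qed

section \<open>Measurability of the kernels\<close>

lemma borel_measurable_component:
  assumes "v \<in> V"
  shows "(\<lambda>k. k v) \<in> borel_measurable (Pi\<^sub>M V (\<lambda>_. lborel))"
  using measurable_component_singleton[OF assms, of "\<lambda>_. lborel"] by simp

lemma borel_measurable_delta:
  assumes "U \<subseteq> V"
  shows "delta E q U \<in> borel_measurable (Pi\<^sub>M V (\<lambda>_. lborel))"
  unfolding delta_def[abs_def] using assms
  by (intro borel_measurable_sum borel_measurable_times borel_measurable_prod borel_measurable_component) auto

lemma borel_measurable_Delta:
  assumes "U \<subseteq> V"
  shows "Delta E q U \<in> borel_measurable (Pi\<^sub>M V (\<lambda>_. lborel))"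
  unfolding Delta_def[abs_def] using assms
  by (intro borel_measurable_sum borel_measurable_times borel_measurable_prod borel_measurable_component) auto

lemma borel_measurable_prod_powr:
  fixes a :: "'v \<Rightarrow> real"
  shows "(\<lambda>k. \<Prod>v\<in>V. k v powr (a v - 1)) \<in> borel_measurable (Pi\<^sub>M V (\<lambda>_. lborel))"
  by (intro borel_measurable_prod powr_real_measurable borel_measurable_component) auto

lemma borel_measurable_TB_I_kernel:
  assumes "finite V"
  shows "TB_I_kernel V E a \<beta> q \<in> borel_measurable (Pi\<^sub>M V (\<lambda>_. lborel))"
proof -
  let ?M = "Pi\<^sub>M V (\<lambda>_. lborel :: real measure)"
  have "TB_domain V E q =
      {k \<in> space ?M. (\<forall>v\<in>V. 0 < k v \<and> k v < 1) \<and> (\<forall>U\<in>Pow V. 0 < Delta E q U k)}"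
    by (auto simp: TB_domain_def space_PiM PiE_iff)
  also have "\<dots> \<in> sets ?M"
    using assms
    by (intro sets.sets_Collect_conj sets.sets_Collect_finite_All borel_measurable_less
        borel_measurable_component borel_measurable_Delta borel_measurable_const) auto
  finally show ?thesis
    unfolding TB_I_kernel_def[abs_def]
    by (intro borel_measurable_times powr_real_measurable borel_measurable_prod_powr
        borel_measurable_Delta borel_measurable_const borel_measurable_indicator) auto
qed

lemma borel_measurable_TB_II_kernel:
  assumes "finite V"
  shows "TB_II_kernel V E a \<beta> q \<in> borel_measurable (Pi\<^sub>M V (\<lambda>_. lborel))"
proof -
  let ?M = "Pi\<^sub>M V (\<lambda>_. lborel :: real measure)"
  have "PiE V (\<lambda>_. {0<..}) \<in> sets ?M" using assms by (intro sets_PiM_I_finite) auto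
  then show ?thesis
    unfolding TB_II_kernel_def[abs_def]
    by (intro borel_measurable_times powr_real_measurable borel_measurable_prod_powr
        borel_measurable_delta borel_measurable_const borel_measurable_indicator) auto
qed

section \<open>The kernels when a leaf is removed\<close>

text \<open>Expressing x_p^(a_p - 1) through the scaled coordinate costs the factor s^(1 -
  a_p).\<close>

lemma prod_powr_scale:
  fixes x :: "'v \<Rightarrow> real"
  assumes "finite U" "p \<in> U" "l \<notin> U" "0 \<le> x p" "0 < s"
  shows "(\<Prod>v\<in>insert l U. (x(l := y)) v powr (a v - 1)) =
    y powr (a l - 1) * s powr (1 - a p) * (\<Prod>v\<in>U. (x(p := x p * s)) v powr (a v - 1))"
proof -
  have "(\<Prod>v\<in>insert l U. (x(l := y)) v powr (a v - 1)) =
      y powr (a l - 1) * (\<Prod>v\<in>U. (x(l := y)) v powr (a v - 1))"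
    using assms by simp
  also have "(\<Prod>v\<in>U. (x(l := y)) v powr (a v - 1)) = (\<Prod>v\<in>U. x v powr (a v - 1))"
    using assms by (intro prod.cong) auto
  also have "\<dots> = x p powr (a p - 1) * (\<Prod>v\<in>U - {p}. x v powr (a v - 1))"
    by (rule prod.remove[OF assms(1,2)])
  also have "x p powr (a p - 1) = s powr (1 - a p) * (x p * s) powr (a p - 1)"
    using assms powr_add[of s "1 - a p" "a p - 1"] by (simp add: powr_mult)
  also have "(\<Prod>v\<in>U - {p}. x v powr (a v - 1)) = (\<Prod>v\<in>U - {p}. (x(p := x p * s)) v powr (a v - 1))"
    by (intro prod.cong) auto
  also have "s powr (1 - a p) * (x p * s) powr (a p - 1) * \<dots> =
      s powr (1 - a p) * (\<Prod>v\<in>U. (x(p := x p * s)) v powr (a v - 1))"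
    using prod.remove[OF assms(1,2), of "\<lambda>v. (x(p := x p * s)) v powr (a v - 1)"] by simp
  finally show ?thesis by (simp only: mult.assoc)
qed

lemma TB_I_kernel_leaf:
  assumes gU: "grown_tree U F" and pl: "p \<in> U" "l \<notin> U"
    and q: "q {l, p} < 1" and x: "x \<in> PiE U (\<lambda>_. UNIV)"
  defines "s \<equiv> \<lambda>y. (1 - q {l, p} * y) / (1 - y)"
  shows "TB_I_kernel (insert l U) (insert {l, p} F) a \<beta> q (x(l := y)) =
    indicator {0<..<1} y * y powr (a l - 1) * (1 - y) powr (\<beta> - 1) * s y powr (1 - a p) *
    TB_I_kernel U F a \<beta> q (x(p := x p * s y))"
proof (cases "x(l := y) \<in> TB_domain (insert l U) (insert {l, p} F) q")
  case False
  then have "y \<notin> {0<..<1} \<or> x(p := x p * s y) \<notin> TB_domain U F q"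
    using TB_domain_leaf[of U F p l q x, OF gU pl q x, of y] by (auto simp: s_def)
  then show ?thesis using False by (auto simp: TB_I_kernel_def)
next
  case True
  then have y: "0 < y" "y < 1" and k: "x(p := x p * s y) \<in> TB_domain U F q"
    using TB_domain_leaf[of U F p l q x, OF gU pl q x, of y] by (auto simp: s_def)
  have "q {l, p} * y < 1 * y" using q y by (intro mult_strict_right_mono) auto
  then have "q {l, p} * y < 1" using y by linarith
  then have s: "0 < s y" using y by (simp add: s_def)
  have "x p > 0" using True pl by (auto simp: TB_domain_def PiE_iff fun_upd_apply split: if_splits)
  then have P: "(\<Prod>v\<in>insert l U. (x(l := y)) v powr (a v - 1)) =
    y powr (a l - 1) * s y powr (1 - a p) * (\<Prod>v\<in>U. (x(p := x p * s y)) v powr (a v - 1))"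
    using s grown_treeD(1)[OF gU] pl by (intro prod_powr_scale) auto
  have "Delta F q U (x(l := y, p := x p * s y)) = Delta F q U (x(p := x p * s y))"
    using pl by (intro Delta_cong) auto
  then have "Delta (insert {l, p} F) q (insert l U) (x(l := y)) = (1 - y) * Delta F q U (x(p := x p * s y))"
    using Delta_leaf(2)[OF gU pl order_refl, of "x(l := y)" q] y pl by (auto simp: s_def)
  moreover have "0 < Delta F q U (x(p := x p * s y))" using k by (auto simp: TB_domain_def)
  ultimately show ?thesis
    unfolding TB_I_kernel_def P using True k y by (simp add: powr_mult del: fun_upd_apply)
qed

lemma TB_II_kernel_leaf:
  assumes gU: "grown_tree U F" and pl: "p \<in> U" "l \<notin> U"
    and q: "\<And>e. e \<in> insert {l, p} F \<Longrightarrow> 0 \<le> q e" and x: "x \<in> PiE U (\<lambda>_. UNIV)"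
  defines "s \<equiv> \<lambda>y. (1 + q {l, p} * y) / (1 + y)"
  shows "TB_II_kernel (insert l U) (insert {l, p} F) a \<beta> q (x(l := y)) =
    indicator {0<..} y * y powr (a l - 1) * (1 + y) powr (- \<beta>) * s y powr (1 - a p) *
    TB_II_kernel U F a \<beta> q (x(p := x p * s y))"
proof (cases "0 < y")
  case False
  then show ?thesis by (auto simp: TB_II_kernel_def PiE_iff)
next
  case y: True
  have s: "0 < s y" using q[of "{l, p}"] y by (simp add: s_def add_pos_nonneg)
  have iff: "x(l := y) \<in> PiE (insert l U) (\<lambda>_. {0<..}) \<longleftrightarrow> x(p := x p * s y) \<in> PiE U (\<lambda>_. {0<..})"
    using x pl y s by (auto simp: PiE_iff extensional_def zero_less_mult_iff split: if_splits)
  show ?thesis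
  proof (cases "x(l := y) \<in> PiE (insert l U) (\<lambda>_. {0<..})")
    case False
    then show ?thesis using iff by (simp add: TB_II_kernel_def del: fun_upd_apply)
  next
    case True
    have "x p > 0" using True pl by (auto simp: PiE_iff fun_upd_apply split: if_splits)
    then have P: "(\<Prod>v\<in>insert l U. (x(l := y)) v powr (a v - 1)) =
      y powr (a l - 1) * s y powr (1 - a p) * (\<Prod>v\<in>U. (x(p := x p * s y)) v powr (a v - 1))"
      using s grown_treeD(1)[OF gU] pl by (intro prod_powr_scale) auto
    have "delta F q U (x(l := y, p := x p * s y)) = delta F q U (x(p := x p * s y))"
      using pl by (intro delta_cong) auto
    then have "delta (insert {l, p} F) q (insert l U) (x(l := y)) = (1 + y) * delta F q U (x(p := x p * s y))"
      using delta_leaf(2)[OF gU pl order_refl, of "x(l := y)" q] y pl by (auto simp: s_def)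
    moreover have "0 < delta F q U (x(p := x p * s y))"
      using grown_treeD[OF gU] q True iff by (intro delta_pos) (auto simp: PiE_iff simp del: fun_upd_apply)
    ultimately show ?thesis
      unfolding TB_II_kernel_def P using True iff y by (simp add: powr_mult del: fun_upd_apply)
  qed
qed

section \<open>The one-dimensional integral of an edge\<close>

text \<open>The map t / (1 - t) carries (0, 1) increasingly onto the positive half-line with
  derivative 1 / (1 - t)^2. The substitution rule concerns Bochner integrals over intervals, so the
  finite value \<open>r\<close> is used to pass to integrability and back.\<close>

lemma nn_integral_substitution_odds:
  fixes f :: "real \<Rightarrow> real"
  assumes f: "f \<in> borel_measurable borel" "\<And>u. 0 < u \<Longrightarrow> isCont f u" "\<And>u. 0 < u \<Longrightarrow> 0 \<le> f u"
    and r: "(\<integral>\<^sup>+t. ennreal (indicator {0<..<1} t * (f (t / (1 - t)) / (1 - t)\<^sup>2)) \<partial>lborel) = ennreal r" "0 \<le> r"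
  shows "(\<integral>\<^sup>+u. ennreal (indicator {0<..} u * f u) \<partial>lborel) = ennreal r"
proof -
  define h where "h = (\<lambda>t::real. t / (1 - t))"
  define h' where "h' = (\<lambda>t::real. 1 / (1 - t)\<^sup>2)"
  have e01: "einterval 0 1 = {0::real<..<1}" by (auto simp: einterval_def zero_ereal_def one_ereal_def)
  have e0: "einterval 0 \<infinity> = {0::real<..}" by (auto simp: einterval_def zero_ereal_def)
  let ?F = "\<lambda>t. indicator {0<..<1} t * (f (h t) * h' t)"
  have F: "?F t = indicator {0<..<1} t * (f (t / (1 - t)) / (1 - t)\<^sup>2)" for t by (simp add: h_def h'_def)
  have hpos: "0 < h t" if "0 < t" "t < 1" for t using that by (simp add: h_def)
  have Fnn: "0 \<le> ?F t" for t using f(3)[OF hpos, of t] by (auto simp: indicator_def h'_def)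
  have Fm: "?F \<in> borel_measurable borel" unfolding h_def h'_def using f(1) by measurable
  have F_int: "integrable lborel ?F" "integral\<^sup>L lborel ?F = r"
    using nn_integral_eq_integrable[of ?F lborel r] Fm Fnn r unfolding F by auto
  have si: "set_integrable lborel (einterval 0 1) (\<lambda>t. f (h t) * h' t)"
    using F_int(1) by (simp add: set_integrable_def e01)
  have lim0: "((ereal \<circ> h \<circ> real_of_ereal) \<longlongrightarrow> 0) (at_right 0)"
  proof -
    have "(h \<longlongrightarrow> 0) (at_right 0)" unfolding h_def by (auto intro!: tendsto_eq_intros)
    then show ?thesis unfolding zero_ereal_def ereal_tendsto_simps1 ereal_tendsto_simps2 .
  qed
  have "filterlim h at_top (at_left 1)" unfolding h_def by real_asymp
  then have lim1: "((ereal \<circ> h \<circ> real_of_ereal) \<longlongrightarrow> \<infinity>) (at_left 1)"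
    unfolding one_ereal_def ereal_tendsto_simps1 ereal_tendsto_simps2 .
  have deriv: "DERIV h t :> h' t" if "0 < ereal t" "ereal t < 1" for t
    using that unfolding h_def h'_def
    by (auto intro!: derivative_eq_intros simp: power2_eq_square field_simps)
  have cont': "isCont h' t" if "0 < ereal t" "ereal t < 1" for t
    using that unfolding h'_def by (auto intro!: continuous_intros)
  have cont: "isCont f (h t)" and nn: "0 \<le> f (h t)" if "0 < ereal t" "ereal t < 1" for t
    using f(2,3)[OF hpos[of t]] that by auto
  have nn': "0 \<le> h' t" for t by (simp add: h'_def)
  note subst = interval_integral_substitution_nonneg[OF _ deriv cont cont' nn nn' lim0 lim1 si]
  have int: "integrable lborel (\<lambda>u. indicator {0<..} u * f u)"
    using subst(1) by (simp add: set_integrable_def e0)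
  have "(LBINT u=0..\<infinity>. f u) = (\<integral>u. indicator {0<..} u * f u \<partial>lborel)"
    by (simp add: interval_lebesgue_integral_def set_lebesgue_integral_def e0)
  moreover have "(LBINT t=0..1. f (h t) * h' t) = r"
    using F_int(2) by (simp add: interval_lebesgue_integral_def set_lebesgue_integral_def e01)
  ultimately have "(\<integral>u. indicator {0<..} u * f u \<partial>lborel) = r" using subst(2) by simp
  then show ?thesis
    using nn_integral_eq_integral[OF int] f(3) by (auto simp: indicator_def)
qed

text \<open>Here \<open>a\<close> belongs to the parent and \<open>b\<close> to the leaf. The power
  s^(1 - a) / s = s^(-a) moves a factor (1 - y)^a to the weight, which raises its exponent to
  \<beta> + a - 1 and gives the third parameter a + b + \<beta>.\<close>

lemma edge_integral_I:
  assumes "0 < a" "0 < b" "0 < \<beta>" "w < 1"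
  shows "(\<integral>\<^sup>+y. ennreal (indicator {0<..<1} y * y powr (b - 1) * (1 - y) powr (\<beta> - 1) *
      ((1 - w * y) / (1 - y)) powr (1 - a) / ((1 - w * y) / (1 - y))) \<partial>lborel) =
    ennreal (Beta b (a + \<beta>) * hyp2F1 a b (b + a + \<beta>) w)"
proof -
  have "indicator {0<..<1} y * y powr (b - 1) * (1 - y) powr (\<beta> - 1) *
      ((1 - w * y) / (1 - y)) powr (1 - a) / ((1 - w * y) / (1 - y)) =
      indicator {0<..<1} y * y powr (b - 1) * (1 - y) powr ((b + a + \<beta>) - b - 1) * (1 - w * y) powr (- a)"
    for y :: real
  proof (cases "0 < y \<and> y < 1")
    case y: True
    then have "w * y < 1 * y" using assms by (intro mult_strict_right_mono) auto
    then have w: "0 < 1 - w * y" using y by linarith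
    define s where "s = (1 - w * y) / (1 - y)"
    have s: "0 < s" using w y by (simp add: s_def)
    have "s powr (1 - a) / s = s powr (- a)" using s powr_diff[of s "1 - a" 1] by simp
    also have "\<dots> = (1 - w * y) powr (- a) * (1 - y) powr a"
      using w y by (simp add: s_def powr_divide powr_minus field_simps)
    finally have E1: "s powr (1 - a) / s = (1 - w * y) powr (- a) * (1 - y) powr a" .
    have E2: "(1 - y) powr ((b + a + \<beta>) - b - 1) = (1 - y) powr (\<beta> - 1) * (1 - y) powr a"
      by (simp add: powr_add[symmetric] algebra_simps)
    show ?thesis
      unfolding s_def[symmetric] times_divide_eq_right[symmetric] E1 E2 by (simp only: mult_ac)
  qed auto
  then show ?thesis using nn_integral_Euler[of a b "b + a + \<beta>" w] assms by simp
qed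

text \<open>With y = t / (1 - t) one has 1 + y = 1 / (1 - t) and (1 + w y) / (1 + y) = 1 - (1 - w)
  t, whence the argument 1 - w. Euler's integral enters as a premise with value \<open>r\<close>, so
  that the root, with a = 0 and w = 1, can be handled by a plain beta integral.\<close>

lemma edge_integral_II:
  assumes w: "0 \<le> w" and r: "(\<integral>\<^sup>+t. ennreal (indicator {0<..<1} t * t powr (b - 1) * (1 - t) powr (\<beta> - b - 1) *
           (1 - (1 - w) * t) powr (- a)) \<partial>lborel) = ennreal r" "0 \<le> r"
  shows "(\<integral>\<^sup>+y. ennreal (indicator {0<..} y * y powr (b - 1) * (1 + y) powr (- \<beta>) *
      ((1 + w * y) / (1 + y)) powr (1 - a) / ((1 + w * y) / (1 + y))) \<partial>lborel) = ennreal r"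
proof -
  define f where "f = (\<lambda>y. y powr (b - 1) * (1 + y) powr (- \<beta>) *
      ((1 + w * y) / (1 + y)) powr (1 - a) / ((1 + w * y) / (1 + y)))"
  have pos: "0 < (1 + w * y) / (1 + y)" "0 < 1 + w * y" if "0 < y" for y
    using that w by (simp_all add: add_pos_nonneg)
  have "(\<integral>\<^sup>+y. ennreal (indicator {0<..} y * f y) \<partial>lborel) = ennreal r"
  proof (rule nn_integral_substitution_odds[OF _ _ _ _ r(2)])
    show "f \<in> borel_measurable borel" unfolding f_def by measurable
    show "isCont f y" if "0 < y" for y
      unfolding f_def using pos[OF that] that by (intro continuous_intros) auto
    show "0 \<le> f y" if "0 < y" for y
      unfolding f_def using pos[OF that] that by auto
    have "indicator {0<..<1} t * (f (t / (1 - t)) / (1 - t)\<^sup>2) =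
      indicator {0<..<1} t * t powr (b - 1) * (1 - t) powr (\<beta> - b - 1) * (1 - (1 - w) * t) powr (- a)" for t
    proof (cases "0 < t \<and> t < 1")
      case t: True
      define s where "s = 1 - (1 - w) * t"
      have s0: "s = 1 - t + w * t" by (simp add: s_def algebra_simps)
      have s: "0 < s" unfolding s0 using t w by (intro add_pos_nonneg) auto
      have e: "1 + t / (1 - t) = 1 / (1 - t)" using t by (simp add: field_simps)
      have "(1 + w * (t / (1 - t))) / (1 + t / (1 - t)) = s"
        unfolding e s0 using t by (simp add: field_simps)
      then have "f (t / (1 - t)) = (t / (1 - t)) powr (b - 1) * (1 / (1 - t)) powr (- \<beta>) * (s powr (1 - a) / s)"
        unfolding f_def e by simp
      also have "s powr (1 - a) / s = s powr (- a)" using s powr_diff[of s "1 - a" 1] by simp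
      also have "(t / (1 - t)) powr (b - 1) = t powr (b - 1) * (1 - t) powr (1 - b)"
        using t by (simp add: powr_divide powr_diff field_simps)
      also have "(1 / (1 - t)) powr (- \<beta>) = (1 - t) powr \<beta>"
        using t by (simp add: powr_divide powr_minus field_simps)
      finally have "f (t / (1 - t)) / (1 - t)\<^sup>2 =
          t powr (b - 1) * ((1 - t) powr (1 - b) * (1 - t) powr \<beta> / (1 - t)\<^sup>2) * s powr (- a)" by simp
      also have "(1 - t) powr (1 - b) * (1 - t) powr \<beta> / (1 - t)\<^sup>2 = (1 - t) powr (\<beta> - b - 1)"
      proof -
        have "(1 - t)\<^sup>2 = (1 - t) powr 2" using t by (simp add: powr_numeral)
        then have "(1 - t) powr (1 - b) * (1 - t) powr \<beta> / (1 - t)\<^sup>2 = (1 - t) powr (1 - b + \<beta> - 2)"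
          by (simp only: powr_add powr_diff)
        then show ?thesis by (simp add: algebra_simps)
      qed
      finally show ?thesis using t by (simp add: s_def)
    qed auto
    then show "(\<integral>\<^sup>+t. ennreal (indicator {0<..<1} t * (f (t / (1 - t)) / (1 - t)\<^sup>2)) \<partial>lborel) = ennreal r"
      using r(1) by simp
  qed
  then show ?thesis by (simp add: f_def mult.assoc)
qed

section \<open>Assembling the constants\<close>

text \<open>Attaching \<open>l\<close> raises only the degree of \<open>p\<close>, by one;
  \<open>c\<close> is the factor this adds for \<open>p\<close>.\<close>

lemma grown_tree_prod_vertices:
  fixes g :: "'v \<Rightarrow> nat \<Rightarrow> 'b :: comm_monoid_mult"
  assumes "grown_tree U F" "p \<in> U" "l \<notin> U"
    and g: "g p (Suc (degree_in U F p)) = g p (degree_in U F p) * c"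
  shows "(\<Prod>v\<in>insert l U. g v (degree_in (insert l U) (insert {l, p} F) v)) =
    g l 1 * c * (\<Prod>v\<in>U. g v (degree_in U F v))"
proof -
  note F = grown_treeD[OF assms(1)] and deg = degree_in_grown_leaf[OF assms(1-3)]
  have "(\<Prod>v\<in>U. g v (degree_in (insert l U) (insert {l, p} F) v)) =
      g p (Suc (degree_in U F p)) * (\<Prod>v\<in>U - {p}. g v (degree_in (insert l U) (insert {l, p} F) v))"
    using prod.remove[OF F(1) assms(2), of "\<lambda>v. g v (degree_in (insert l U) (insert {l, p} F) v)"]
    by (simp add: deg)
  also have "(\<Prod>v\<in>U - {p}. g v (degree_in (insert l U) (insert {l, p} F) v)) =
      (\<Prod>v\<in>U - {p}. g v (degree_in U F v))"
    by (intro prod.cong refl) (simp add: deg)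
  also have "g p (Suc (degree_in U F p)) * \<dots> = c * (\<Prod>v\<in>U. g v (degree_in U F v))"
    using prod.remove[OF F(1) assms(2), of "\<lambda>v. g v (degree_in U F v)"] g by (simp add: mult_ac)
  finally show ?thesis using F(1) assms(3) deg(1) by (simp add: mult_ac)
qed

lemma grown_tree_prod_edges:
  assumes "grown_tree U F" "p \<in> U" "l \<notin> U" "f l p = f p l"
  shows "(\<Prod>e\<in>insert {l, p} F. on_ends f e) = f l p * (\<Prod>e\<in>F. on_ends f e)"
  using grown_treeD[OF assms(1)] assms(3,4) by (subst prod.insert) (auto simp: on_ends_eq)

text \<open>\<open>J\<close> is the reciprocal of the claimed constant. Its positivity is carried
  along: it allows products to be merged inside \<open>ennreal\<close> and the total mass to be
  inverted at the end.\<close>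

lemma TB_I_integral:
  fixes a :: "'v \<Rightarrow> real"
  assumes "grown_tree V E" "\<forall>e\<in>E. q e < 1" "0 < \<beta>" "\<forall>v\<in>V. 0 < a v"
  defines "J \<equiv> \<lambda>V E. Gamma \<beta> *
      (\<Prod>v\<in>V. Gamma (a v) * Gamma (a v + \<beta>) powi (int (degree_in V E v) - 1)) /
      (\<Prod>e\<in>E. on_ends (\<lambda>u w.
             Gamma (a u + a w + \<beta>) / hyp2F1 (a u) (a w) (a u + a w + \<beta>) (q {u, w})) e)"
  shows "(\<integral>\<^sup>+k. ennreal (TB_I_kernel V E a \<beta> q k) \<partial>lebesgue_on_vertices V) = ennreal (J V E) \<and> 0 < J V E"
  using assms(1-4)
proof (induction)
  case (singleton r)
  interpret product_sigma_finite "\<lambda>_::'v. lborel :: real measure" by standard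
  have dom: "k \<in> TB_domain {r} {} q \<longleftrightarrow> k r \<in> {0<..<1}" if "k \<in> PiE {r} (\<lambda>_. UNIV)" for k
    using that by (auto simp: TB_domain_def PiE_iff Delta_def edge_weight_prod_def subset_singleton_iff Pow_insert)
  have "TB_I_kernel {r} {} a \<beta> q k =
      indicator {0<..<1} (k r) * k r powr (a r - 1) * (1 - k r) powr (\<beta> - 1)"
    if "k \<in> PiE {r} (\<lambda>_. UNIV)" for k
    using dom[OF that] by (auto simp: TB_I_kernel_def Delta_def edge_weight_prod_def Pow_insert indicator_def)
  then have "(\<integral>\<^sup>+k. ennreal (TB_I_kernel {r} {} a \<beta> q k) \<partial>lebesgue_on_vertices {r}) =
     (\<integral>\<^sup>+k. ennreal (indicator {0<..<1} (k r) * k r powr (a r - 1) * (1 - k r) powr (\<beta> - 1))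
        \<partial>Pi\<^sub>M {r} (\<lambda>_. lborel :: real measure))"
    unfolding lebesgue_on_vertices_def by (intro nn_integral_cong) (simp add: space_PiM)
  also have "\<dots> = (\<integral>\<^sup>+x. ennreal (indicator {0<..<1} x * x powr (a r - 1) * (1 - x) powr (\<beta> - 1)) \<partial>lborel)"
    by (rule product_nn_integral_singleton) measurable
  \<comment> \<open>The root has degree 0 here, so the exponent -1 provides the denominator
    Gamma(a_r + \<beta>) of the beta function.\<close>
  also have "\<dots> = ennreal (Beta (a r) \<beta>)" using singleton by (intro nn_integral_Beta) auto
  also have "Beta (a r) \<beta> = J {r} {}"
    by (simp add: J_def degree_in_def Beta_def power_int_minus field_simps)
  finally show ?case using Beta_real_pos[of "a r" \<beta>] \<open>Beta (a r) \<beta> = J {r} {}\<close> singleton by simp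
next
  case (leaf U F p l)
  note F = grown_treeD[OF leaf.hyps(1)]
  define w where "w = q {l, p}"
  have pos: "0 < a p" "0 < a l" "w < 1" using leaf by (auto simp: w_def)
  have IH: "(\<integral>\<^sup>+k. ennreal (TB_I_kernel U F a \<beta> q k) \<partial>lebesgue_on_vertices U) = ennreal (J U F)" "0 < J U F"
    using leaf by auto
  define g where "g = (\<lambda>y. indicator {0<..<1} y * y powr (a l - 1) * (1 - y) powr (\<beta> - 1) *
      ((1 - w * y) / (1 - y)) powr (1 - a p))"
  define r where "r = Beta (a l) (a p + \<beta>) * hyp2F1 (a p) (a l) (a l + a p + \<beta>) w"
  have hyp: "0 < hyp2F1 (a p) (a l) (a l + a p + \<beta>) w"
    using pos \<open>0 < \<beta>\<close> by (intro hyp2F1_pos) auto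
  have B: "0 < Beta (a l) (a p + \<beta>)" using pos \<open>0 < \<beta>\<close> by (intro Beta_real_pos) auto
  have "(\<integral>\<^sup>+k. ennreal (TB_I_kernel (insert l U) (insert {l, p} F) a \<beta> q k) \<partial>lebesgue_on_vertices (insert l U)) =
      (\<integral>\<^sup>+y. ennreal (g y / ((1 - w * y) / (1 - y))) \<partial>lborel) *
      (\<integral>\<^sup>+k. ennreal (TB_I_kernel U F a \<beta> q k) \<partial>lebesgue_on_vertices U)"
    unfolding lebesgue_on_vertices_def
  proof (rule nn_integral_PiM_leaf[OF F(1) leaf.hyps(2,3)])
    show "0 < (1 - w * y) / (1 - y)" if "g y \<noteq> 0" for y
    proof -
      have y: "0 < y" "y < 1" using that by (auto simp: g_def indicator_def split: if_splits)
      then have "w * y < 1 * y" using pos by (intro mult_strict_right_mono) auto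
      then show ?thesis using y by (intro divide_pos_pos) linarith+
    qed
    show "TB_I_kernel (insert l U) (insert {l, p} F) a \<beta> q (x(l := y)) =
        g y * TB_I_kernel U F a \<beta> q (x(p := x p * ((1 - w * y) / (1 - y))))"
      if "x \<in> PiE U (\<lambda>_. UNIV)" for x y
      using TB_I_kernel_leaf[OF leaf.hyps, of q x a \<beta> y] that pos(3) by (simp add: g_def w_def)
    show "0 \<le> g y" for y by (auto simp: g_def)
    show "g \<in> borel_measurable borel" unfolding g_def by measurable
  qed (use F in \<open>auto intro: borel_measurable_TB_I_kernel\<close>)
  also have "(\<integral>\<^sup>+y. ennreal (g y / ((1 - w * y) / (1 - y))) \<partial>lborel) = ennreal r"
    unfolding g_def r_def using pos \<open>0 < \<beta>\<close> by (intro edge_integral_I) auto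
  also have "ennreal r * (\<integral>\<^sup>+k. ennreal (TB_I_kernel U F a \<beta> q k) \<partial>lebesgue_on_vertices U) =
      ennreal (r * J U F)"
    unfolding IH(1) using IH(2) by (simp add: ennreal_mult'')
  also have J: "r * J U F = J (insert l U) (insert {l, p} F)"
  proof -
    have G: "0 < Gamma (a p + \<beta>)" using pos \<open>0 < \<beta>\<close> by simp
    \<comment> \<open>\<open>l\<close> enters with degree 1, hence exponent 0, while the exponent at
      \<open>p\<close> grows by one; the new Gamma(a_p + \<beta>) matches the numerator of Beta(a_l,
      a_p + \<beta>).\<close>
    have V: "(\<Prod>v\<in>insert l U. Gamma (a v) * Gamma (a v + \<beta>) powi
        (int (degree_in (insert l U) (insert {l, p} F) v) - 1)) = Gamma (a l) * Gamma (a p + \<beta>) *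
        (\<Prod>v\<in>U. Gamma (a v) * Gamma (a v + \<beta>) powi (int (degree_in U F v) - 1))"
      using grown_tree_prod_vertices[OF leaf.hyps,
        of "\<lambda>v n. Gamma (a v) * Gamma (a v + \<beta>) powi (int n - 1)" "Gamma (a p + \<beta>)"] G
      by (simp add: power_int_diff)
    let ?f = "\<lambda>u w. Gamma (a u + a w + \<beta>) / hyp2F1 (a u) (a w) (a u + a w + \<beta>) (q {u, w})"
    have "(\<Prod>e\<in>insert {l, p} F. on_ends ?f e) = ?f l p * (\<Prod>e\<in>F. on_ends ?f e)"
      using leaf.hyps by (intro grown_tree_prod_edges)
        (auto simp: hyp2F1_commute[of "a l"] insert_commute add.commute[of "a l"])
    also have "?f l p = Gamma (a l + a p + \<beta>) / hyp2F1 (a p) (a l) (a l + a p + \<beta>) w"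
      by (simp add: w_def hyp2F1_commute[of "a l"])
    finally show ?thesis unfolding J_def V by (simp add: r_def Beta_def add_ac)
  qed
  finally show ?case using IH(2) B hyp by (simp add: J[symmetric] r_def)
qed

lemma TB_II_integral:
  fixes a :: "'v \<Rightarrow> real"
  assumes "grown_tree V E" "\<forall>e\<in>E. 0 \<le> q e" "\<forall>v\<in>V. 0 < a v \<and> a v < \<beta>"
    "\<forall>u v. {u, v} \<in> E \<and> q {u, v} = 0 \<longrightarrow> a u + a v < \<beta>"
  defines "J \<equiv> \<lambda>V E. (\<Prod>v\<in>V. Gamma (a v) * Gamma (\<beta> - a v)) / Gamma \<beta> ^ card V *
      (\<Prod>e\<in>E. on_ends (\<lambda>u w. hyp2F1 (a u) (a w) \<beta> (1 - q {u, w})) e)"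
  shows "(\<integral>\<^sup>+k. ennreal (TB_II_kernel V E a \<beta> q k) \<partial>lebesgue_on_vertices V) = ennreal (J V E) \<and> 0 < J V E"
  using assms(1-4)
proof (induction)
  case (singleton r)
  interpret product_sigma_finite "\<lambda>_::'v. lborel :: real measure" by standard
  have B: "0 < Beta (a r) (\<beta> - a r)" using singleton by (intro Beta_real_pos) auto
  have "TB_II_kernel {r} {} a \<beta> q k = indicator {0<..} (k r) * k r powr (a r - 1) * (1 + k r) powr (- \<beta>)"
    if "k \<in> PiE {r} (\<lambda>_. UNIV)" for k
    using that by (auto simp: TB_II_kernel_def delta_def edge_weight_prod_def Pow_insert indicator_def PiE_iff add_ac)
  then have "(\<integral>\<^sup>+k. ennreal (TB_II_kernel {r} {} a \<beta> q k) \<partial>lebesgue_on_vertices {r}) =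
     (\<integral>\<^sup>+k. ennreal (indicator {0<..} (k r) * k r powr (a r - 1) * (1 + k r) powr (- \<beta>))
        \<partial>Pi\<^sub>M {r} (\<lambda>_. lborel :: real measure))"
    unfolding lebesgue_on_vertices_def by (intro nn_integral_cong) (simp add: space_PiM)
  also have "\<dots> = (\<integral>\<^sup>+x. ennreal (indicator {0<..} x * x powr (a r - 1) * (1 + x) powr (- \<beta>)) \<partial>lborel)"
    by (rule product_nn_integral_singleton) measurable
  \<comment> \<open>Inserting a trivial scale factor (weight 1, parent parameter 0) brings the root
    integral into the form of an edge integral.\<close>
  also have "\<dots> = (\<integral>\<^sup>+y. ennreal (indicator {0<..} y * y powr (a r - 1) * (1 + y) powr (- \<beta>) *
      ((1 + 1 * y) / (1 + y)) powr (1 - 0) / ((1 + 1 * y) / (1 + y))) \<partial>lborel)"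
    by (intro nn_integral_cong) (auto simp: indicator_def)
  also have "\<dots> = ennreal (Beta (a r) (\<beta> - a r))"
  proof (rule edge_integral_II)
    show "(\<integral>\<^sup>+t. ennreal (indicator {0<..<1} t * t powr (a r - 1) * (1 - t) powr (\<beta> - a r - 1) *
           (1 - (1 - 1) * t) powr (- 0)) \<partial>lborel) = ennreal (Beta (a r) (\<beta> - a r))"
      using nn_integral_Beta[of "a r" "\<beta> - a r"] singleton by simp
  qed (use B in auto)
  also have "Beta (a r) (\<beta> - a r) = J {r} {}" by (simp add: J_def Beta_def)
  finally show ?case using B \<open>Beta (a r) (\<beta> - a r) = J {r} {}\<close> by simp
next
  case (leaf U F p l)
  note F = grown_treeD[OF leaf.hyps(1)]
  define w where "w = q {l, p}"
  have pos: "0 < a p" "0 < a l" "0 \<le> w" "a l < \<beta>" using leaf by (auto simp: w_def)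
  \<comment> \<open>The argument 1 - w equals 1 exactly at weight 0, where the extra condition on
    adjacent parameters gives convergence.\<close>
  have w: "1 - w < 1 \<or> 1 - w = 1 \<and> a p + a l < \<beta>"
    using leaf.prems(3) pos by (auto simp: w_def add.commute)
  have IH: "(\<integral>\<^sup>+k. ennreal (TB_II_kernel U F a \<beta> q k) \<partial>lebesgue_on_vertices U) = ennreal (J U F)" "0 < J U F"
    using leaf by auto
  define g where "g = (\<lambda>y. indicator {0<..} y * y powr (a l - 1) * (1 + y) powr (- \<beta>) *
      ((1 + w * y) / (1 + y)) powr (1 - a p))"
  define r where "r = Beta (a l) (\<beta> - a l) * hyp2F1 (a p) (a l) \<beta> (1 - w)"
  have hyp: "0 < hyp2F1 (a p) (a l) \<beta> (1 - w)" using pos w by (intro hyp2F1_pos)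
  have B: "0 < Beta (a l) (\<beta> - a l)" using pos by (intro Beta_real_pos) auto
  have "(\<integral>\<^sup>+k. ennreal (TB_II_kernel (insert l U) (insert {l, p} F) a \<beta> q k) \<partial>lebesgue_on_vertices (insert l U)) =
      (\<integral>\<^sup>+y. ennreal (g y / ((1 + w * y) / (1 + y))) \<partial>lborel) *
      (\<integral>\<^sup>+k. ennreal (TB_II_kernel U F a \<beta> q k) \<partial>lebesgue_on_vertices U)"
    unfolding lebesgue_on_vertices_def
  proof (rule nn_integral_PiM_leaf[OF F(1) leaf.hyps(2,3)])
    show "0 < (1 + w * y) / (1 + y)" if "g y \<noteq> 0" for y
      using that pos by (auto simp: g_def indicator_def intro!: divide_pos_pos add_pos_nonneg split: if_splits)
    show "TB_II_kernel (insert l U) (insert {l, p} F) a \<beta> q (x(l := y)) =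
        g y * TB_II_kernel U F a \<beta> q (x(p := x p * ((1 + w * y) / (1 + y))))"
      if "x \<in> PiE U (\<lambda>_. UNIV)" for x y
      using TB_II_kernel_leaf[OF leaf.hyps, of q x a \<beta> y] that leaf.prems(1) by (simp add: g_def w_def)
    show "0 \<le> g y" for y by (auto simp: g_def indicator_def)
    show "g \<in> borel_measurable borel" unfolding g_def by measurable
  qed (use F in \<open>auto intro: borel_measurable_TB_II_kernel\<close>)
  also have "(\<integral>\<^sup>+y. ennreal (g y / ((1 + w * y) / (1 + y))) \<partial>lborel) = ennreal r"
    unfolding g_def r_def using pos w B hyp by (intro edge_integral_II nn_integral_Euler) auto
  also have "ennreal r * (\<integral>\<^sup>+k. ennreal (TB_II_kernel U F a \<beta> q k) \<partial>lebesgue_on_vertices U) =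
      ennreal (r * J U F)"
    unfolding IH(1) using IH(2) by (simp add: ennreal_mult'')
  also have J: "r * J U F = J (insert l U) (insert {l, p} F)"
  proof -
    let ?f = "\<lambda>u w. hyp2F1 (a u) (a w) \<beta> (1 - q {u, w})"
    have "(\<Prod>e\<in>insert {l, p} F. on_ends ?f e) = ?f l p * (\<Prod>e\<in>F. on_ends ?f e)"
      using leaf.hyps by (intro grown_tree_prod_edges)
        (auto simp: hyp2F1_commute[of "a l"] insert_commute)
    also have "?f l p = hyp2F1 (a p) (a l) \<beta> (1 - w)"
      by (simp add: w_def hyp2F1_commute[of "a l"])
    finally show ?thesis
      unfolding J_def using F(1) leaf.hyps(3) by (simp add: r_def Beta_def)
  qed
  finally show ?case using IH(2) B hyp by (simp add: J[symmetric] r_def)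
qed

text \<open>For a nonnegative kernel a finite positive \<open>ennreal\<close> integral determines
  the Bochner integral, which excludes its default value 0.\<close>

lemma normalizing_const_prob_space:
  fixes f :: "('v \<Rightarrow> real) \<Rightarrow> real"
  assumes f: "f \<in> borel_measurable (lebesgue_on_vertices V)" "\<And>k. 0 \<le> f k"
    and J: "(\<integral>\<^sup>+k. ennreal (f k) \<partial>lebesgue_on_vertices V) = ennreal J \<and> 0 < J"
  shows "normalizing_const V f = 1 / J"
    and "prob_space (density (lebesgue_on_vertices V) (\<lambda>k. ennreal (normalizing_const V f * f k)))"
proof -
  have "(\<integral>k. f k \<partial>lebesgue_on_vertices V) = J"
    using f J by (subst integral_eq_nn_integral) auto
  then show c: "normalizing_const V f = 1 / J" by (simp add: normalizing_const_def)
  have "(\<integral>\<^sup>+k. ennreal (1 / J * f k) \<partial>lebesgue_on_vertices V) = ennreal (1 / J) * ennreal J"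
    using f J by (simp add: ennreal_mult' nn_integral_cmult del: times_divide_eq_left)
  also have "\<dots> = 1" using J by (simp add: ennreal_mult'[symmetric])
  finally have "(\<integral>\<^sup>+k. ennreal (1 / J * f k) \<partial>lebesgue_on_vertices V) = 1" .
  then show "prob_space (density (lebesgue_on_vertices V) (\<lambda>k. ennreal (normalizing_const V f * f k)))"
    unfolding c using f(1)
    by (intro prob_spaceI) (auto simp: emeasure_density cong: nn_integral_cong)
qed

theorem corollary3p1:
  fixes V :: "'v set" and E :: "'v set set"
    and q :: "'v set \<Rightarrow> real" and a :: "'v \<Rightarrow> real" and \<beta> :: real
  assumes "finite V" and "1 < card V" and "tree_graph V E"
  shows
    "((\<forall>e\<in>E. q e < 1) \<and> 0 < \<beta> \<and> (\<forall>v\<in>V. 0 < a v) \<longrightarrow>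
        prob_space (TB_I V E a \<beta> q) \<and>
        c_I V E a \<beta> q =
          1 / (Gamma \<beta> *
               (\<Prod>v\<in>V. Gamma (a v) * Gamma (a v + \<beta>) powi (int (degree_in V E v) - 1))) *
          (\<Prod>e\<in>E. on_ends (\<lambda>u w.
             Gamma (a u + a w + \<beta>) / hyp2F1 (a u) (a w) (a u + a w + \<beta>) (q {u, w})) e)) \<and>
     ((\<forall>e\<in>E. 0 \<le> q e) \<and> 0 < \<beta> \<and> (\<forall>v\<in>V. 0 < a v \<and> a v < \<beta>) \<and>
      (\<forall>u v. {u, v} \<in> E \<and> q {u, v} = 0 \<longrightarrow> a u + a v < \<beta>) \<longrightarrow>
        prob_space (TB_II V E a \<beta> q) \<and>
        c_II V E a \<beta> q =
          Gamma \<beta> ^ card V / (\<Prod>v\<in>V. Gamma (a v) * Gamma (\<beta> - a v)) *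
          (1 / (\<Prod>e\<in>E. on_ends (\<lambda>u w. hyp2F1 (a u) (a w) \<beta> (1 - q {u, w})) e)))"
proof (intro conjI impI)
  have tree: "grown_tree V E" using tree_graph_imp_grown_tree assms by blast
  {
    assume h: "(\<forall>e\<in>E. q e < 1) \<and> 0 < \<beta> \<and> (\<forall>v\<in>V. 0 < a v)"
    have m: "TB_I_kernel V E a \<beta> q \<in> borel_measurable (lebesgue_on_vertices V)"
      unfolding lebesgue_on_vertices_def using assms(1) by (rule borel_measurable_TB_I_kernel)
    have nn: "0 \<le> TB_I_kernel V E a \<beta> q k" for k
      unfolding TB_I_kernel_def by (intro mult_nonneg_nonneg prod_nonneg) auto
    note N = normalizing_const_prob_space[OF m nn TB_I_integral[OF tree]]
    show "prob_space (TB_I V E a \<beta> q)" unfolding TB_I_def c_I_def using h by (intro N(2)) auto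
    show "c_I V E a \<beta> q =
          1 / (Gamma \<beta> *
               (\<Prod>v\<in>V. Gamma (a v) * Gamma (a v + \<beta>) powi (int (degree_in V E v) - 1))) *
          (\<Prod>e\<in>E. on_ends (\<lambda>u w.
             Gamma (a u + a w + \<beta>) / hyp2F1 (a u) (a w) (a u + a w + \<beta>) (q {u, w})) e)"
      unfolding c_I_def using h by (subst N(1)) auto
  next
    assume h: "(\<forall>e\<in>E. 0 \<le> q e) \<and> 0 < \<beta> \<and> (\<forall>v\<in>V. 0 < a v \<and> a v < \<beta>) \<and>
      (\<forall>u v. {u, v} \<in> E \<and> q {u, v} = 0 \<longrightarrow> a u + a v < \<beta>)"
    have m: "TB_II_kernel V E a \<beta> q \<in> borel_measurable (lebesgue_on_vertices V)"
      unfolding lebesgue_on_vertices_def using assms(1) by (rule borel_measurable_TB_II_kernel)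
    have nn: "0 \<le> TB_II_kernel V E a \<beta> q k" for k
      unfolding TB_II_kernel_def by (intro mult_nonneg_nonneg prod_nonneg) auto
    note N = normalizing_const_prob_space[OF m nn TB_II_integral[OF tree]]
    show "prob_space (TB_II V E a \<beta> q)" unfolding TB_II_def c_II_def using h by (intro N(2)) auto
    show "c_II V E a \<beta> q =
          Gamma \<beta> ^ card V / (\<Prod>v\<in>V. Gamma (a v) * Gamma (\<beta> - a v)) *
          (1 / (\<Prod>e\<in>E. on_ends (\<lambda>u w. hyp2F1 (a u) (a w) \<beta> (1 - q {u, w})) e))"
      unfolding c_II_def using h by (subst N(1)) (auto simp: field_simps)
  }
qed

end
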